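(* Suppose $Q=-Q\subset\mathbb{R}^n$ is a parallelotope whose outer unit normals are $\{\pm u_1,\ldots,\pm u_n\}$, and $K\subset\mathbb{R}^n$ is a centered convex body such that $h_K(u_i)/h_K(-u_i)$ is independent of $i\in\{1,\dots,n\}$. Then $$\int_{\mathbb{S}^{n-1}}\log\frac{h_K(u)}{h_Q(u)}\,dV_Q(u)\ \ge\ \frac{\mathrm{vol}(Q)}{n}\log\frac{\mathrm{vol}(K)}{\mathrm{vol}(Q)}.$$
   Context: A convex body is a compact convex set with non-empty interior. $\mathrm{vol}$ is Lebesgue measure on $\mathbb{R}^n$. A convex body $K$ is centered if its barycenter $b(K)=\frac{1}{\mathrm{vol}(K)}\int_K x\,dx$ is the origin. $h_B(u)=\max_{x\in B}\langle x,u\rangle$ is the support function of a convex body $B$ in direction $u\in\mathbb{S}^{n-1}$. For a convex body $L$ containing the origin, $V_L$ is its cone-volume measure: the Borel measure on $\mathbb{S}^{n-1}$ given by $V_L(\omega)=\frac1n\int_{\nu_L^{-1}(\omega)}\langle x,\nu_L(x)\rangle\,d\mathcal{H}^{n-1}(x)$, where $\nu_L$ is the ($\mathcal{H}^{n-1}$-almost everywhere defined) outer unit normal map on $\partial L$. Equivalently, for a polytope $L$, $V_L$ is the discrete measure assigning to each facet's outer unit normal the volume of the cone (convex hull) of that facet with the origin. *)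

theory Defs
  imports "HOL-Analysis.Analysis"
begin

definition convex_body :: "'a::euclidean_space set \<Rightarrow> bool" where
  "convex_body K \<longleftrightarrow> compact K \<and> convex K \<and> interior K \<noteq> {}"

definition barycenter :: "'a::euclidean_space set \<Rightarrow> 'a" where
  "barycenter K = (1 / measure lebesgue K) *\<^sub>R (LINT x:K|lebesgue. x)"

definition centered :: "'a::euclidean_space set \<Rightarrow> bool" where
  "centered K \<longleftrightarrow> barycenter K = 0"

definition support_fun :: "'a::euclidean_space set \<Rightarrow> 'a \<Rightarrow> real" where
  "support_fun B u = (SUP x\<in>B. x \<bullet> u)"


subsection \<open>Hausdorff measure\<close>

text \<open>Nonempty sets are charged \<open>diameter ^ k\<close>, also for \<open>k = 0\<close>, where a point counts 1;
  empty members of a cover are free.\<close>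

definition hausdorff_pre :: "nat \<Rightarrow> real \<Rightarrow> 'a::metric_space set \<Rightarrow> ennreal" where
  "hausdorff_pre k d A =
     (INF C \<in> {C :: nat \<Rightarrow> 'a set. A \<subseteq> (\<Union>i. C i) \<and> (\<forall>i. bounded (C i) \<and> diameter (C i) \<le> d)}.
        \<Sum>i. if C i = {} then 0 else ennreal (diameter (C i) ^ k))"

definition hausdorff_outer :: "nat \<Rightarrow> 'a::metric_space set \<Rightarrow> ennreal" where
  "hausdorff_outer k A = (SUP d \<in> {0<..}. hausdorff_pre k d A)"

text \<open>A unit cube spanned by \<open>k\<close> coordinate directions. By isometry invariance of
  \<open>hausdorff_outer\<close> it does not matter which ones are chosen.\<close>

definition coord_unit_cube :: "nat \<Rightarrow> 'a::euclidean_space set" where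
  "coord_unit_cube k =
     (let B = (SOME B. B \<subseteq> (Basis :: 'a set) \<and> card B = k)
      in {x. (\<forall>b\<in>B. 0 \<le> x \<bullet> b \<and> x \<bullet> b \<le> 1) \<and> (\<forall>b\<in>Basis - B. x \<bullet> b = 0)})"

text \<open>The \<open>k\<close>-dimensional Hausdorff measure (for \<open>k \<le> DIM('a)\<close>) on the Borel sets, with the
  usual normalisation under which it agrees with \<open>k\<close>-dimensional Lebesgue measure on
  \<open>k\<close>-dimensional planes: a \<open>k\<close>-dimensional unit cube has measure 1.\<close>

definition hausdorff_measure :: "nat \<Rightarrow> 'a::euclidean_space measure" where
  "hausdorff_measure k =
     measure_of UNIV (sets borel)
       (\<lambda>A. hausdorff_outer k A / hausdorff_outer k (coord_unit_cube k :: 'a set))"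


subsection \<open>Gauss map and cone-volume measure\<close>

definition outer_unit_normal_at :: "'a::euclidean_space set \<Rightarrow> 'a \<Rightarrow> 'a \<Rightarrow> bool" where
  "outer_unit_normal_at L x u \<longleftrightarrow> norm u = 1 \<and> (\<forall>y\<in>L. y \<bullet> u \<le> x \<bullet> u)"

definition regular_boundary :: "'a::euclidean_space set \<Rightarrow> 'a set" where
  "regular_boundary L = {x \<in> frontier L. \<exists>!u. outer_unit_normal_at L x u}"

definition gauss_map :: "'a::euclidean_space set \<Rightarrow> 'a \<Rightarrow> 'a" where
  "gauss_map L x = (THE u. outer_unit_normal_at L x u)"

text \<open>Unfolding \<open>distr\<close> and \<open>density\<close>, the value on a Borel set \<open>\<omega>\<close> of the sphere is the integral
  of \<open>(x \<bullet> gauss_map L x) / DIM('a)\<close> over \<open>{x \<in> regular_boundary L. gauss_map L x \<in> \<omega>}\<close> against the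
  Hausdorff measure of dimension \<open>DIM('a) - 1\<close>. The integrand is nonnegative when \<open>0 \<in> L\<close>.\<close>

definition cone_volume_measure :: "'a::euclidean_space set \<Rightarrow> 'a measure" where
  "cone_volume_measure L =
     distr
       (density (restrict_space (hausdorff_measure (DIM('a) - 1)) (regular_boundary L))
          (\<lambda>x. ennreal ((x \<bullet> gauss_map L x) / DIM('a))))
       (restrict_space borel (sphere 0 1))
       (gauss_map L)"


subsection \<open>Parallelotopes\<close>

definition parallelotope :: "'a::euclidean_space set \<Rightarrow> bool" where
  "parallelotope Q \<longleftrightarrow> (\<exists>f p. linear f \<and> inj f \<and> Q = (\<lambda>x. p + f x) ` cbox (0::'a) One)"

definition facet_normals :: "'a::euclidean_space set \<Rightarrow> 'a set" where
  "facet_normals Q = {u. norm u = 1 \<and> {x \<in> Q. x \<bullet> u = support_fun Q u} facet_of Q}"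

end

theory Submission
  imports Defs
begin

text \<open>
Choose linear coordinates in which \<open>Q\<close> is the cube with all coordinates between \<open>- 1\<close> and 1. Let
\<open>g b\<close> be the vector whose inner product with \<open>x\<close> is the coordinate of \<open>x\<close> with index \<open>b\<close>, and write
\<open>\<alpha> b\<close> and \<open>\<beta> b\<close> for the values of the support function of \<open>K\<close> at \<open>g b\<close> and \<open>- g b\<close>.
The cone-volume measure of \<open>Q\<close> gives each of the \<open>2 * n\<close> facet normals the mass \<open>vol Q / (2 * n)\<close>, so the left-hand side is \<open>vol Q / (2 * n)\<close> times the sum of
\<open>ln (\<alpha> b) + ln (\<beta> b)\<close>. The claim is therefore equivalent to the volume bound
\<open>vol K \<le> vol Q * (\<Prod>b. sqrt (\<alpha> b * \<beta> b))\<close>, which is \<open>centered_volume_le\<close>.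

For the volume bound let \<open>v\<close> be any vector. Since \<open>K\<close> is centered and \<open>1 - x \<bullet> v \<le> exp (- (x \<bullet> v))\<close>,
the volume of \<open>K\<close> is at most the integral of \<open>exp (- (x \<bullet> v))\<close> over \<open>K\<close>, hence at most that over the box
containing \<open>K\<close>. There the integral factorises over the coordinates, and for the slope
\<open>l = (\<alpha> - \<beta>) / (2 * \<alpha> * \<beta>)\<close> the integral of \<open>exp (- l * y)\<close> from \<open>- \<beta>\<close> to \<open>\<alpha>\<close> is at most
\<open>2 * sqrt (\<alpha> * \<beta>)\<close> (\<open>exp_integral_le_geometric_mean\<close>).

The mass of a facet normal requires the Hausdorff measure of a facet. Hausdorff outer measure is
additive on separated sets, so it is a measure on the Borel sets by Caratheodory's criterion. The
measure obtained by integrating the Hausdorff measure of parallel slices is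
translation-invariant and hence Lebesgue measure (\<open>lborel_slices\<close>). Applied to \<open>Q\<close> and the slices
parallel to a facet, all of which are translates of that facet, this gives the area of the facet
as \<open>vol Q\<close> divided by twice its distance from the origin.
\<close>

section \<open>Outer measures that are additive on separated sets\<close>

text \<open>
Caratheodory's criterion. Cut \<open>E - F\<close> into the shells \<open>R j\<close> of points whose distance to \<open>F\<close>
lies between \<open>1 / (j + 2)\<close> and \<open>1 / (j + 1)\<close>. Two shells that are not neighbours are a positive
distance apart, so the sum of \<open>f (R j)\<close> over all \<open>j\<close> is at most \<open>2 * f E\<close>. It therefore has
small tails, and \<open>E - F\<close> may be replaced by its part \<open>S j\<close> outside a neighbourhood of \<open>F\<close>, on
which \<open>f\<close> is additive together with \<open>E \<inter> F\<close>.
\<close>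

lemma metric_outer_measure_closed:
  fixes f :: "'a::metric_space set \<Rightarrow> ennreal"
  assumes om: "outer_measure_space UNIV f"
    and metric: "\<And>A B d. \<lbrakk>0 < d; \<And>x y. \<lbrakk>x \<in> A; y \<in> B\<rbrakk> \<Longrightarrow> d \<le> dist x y\<rbrakk> \<Longrightarrow> f A + f B \<le> f (A \<union> B)"
    and F: "closed F"
  shows "f (E \<inter> F) + f (E - F) \<le> f E"
proof (cases "F = {} \<or> f E = \<infinity>")
  case True
  from om have "f {} = 0"
    by (simp add: outer_measure_space_def positive_def)
  with True show ?thesis by auto
next
  case False
  have f0: "f {} = 0" and mono: "\<And>A B. A \<subseteq> B \<Longrightarrow> f A \<le> f B"
    and cs: "countably_subadditive UNIV f"
    using om by (auto simp: outer_measure_space_def positive_def increasing_def)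
  have subadd: "f (\<Union>i. A i) \<le> (\<Sum>i. f (A i))" if "disjoint_family A" for A :: "nat \<Rightarrow> 'a set"
    using cs that by (auto simp: countably_subadditive_def)
  define d where "d x = infdist x F" for x
  define a :: "nat \<Rightarrow> real" where "a i = 1 / (real i + 1)" for i
  define S where "S j = {x \<in> E. a j \<le> d x}" for j
  define R where "R j = {x \<in> E. a (Suc j) \<le> d x \<and> d x < a j}" for j
  have apos: "0 < a i" for i by (simp add: a_def)
  have amono: "a j \<le> a i" if "i \<le> j" for i j using that by (simp add: a_def frac_le)
  have astrict: "a (Suc j) < a j" for j by (simp add: a_def field_simps)
  have d_lip: "d x \<le> d y + dist x y" for x y
    unfolding d_def by (rule infdist_triangle)
  have dpos: "0 < d x" if "x \<notin> F" for x
    using that False F infdist_pos_not_in_closed[of F x] unfolding d_def by simp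
  have sep: "f A + f B \<le> f (A \<union> B)"
    if "t < s" "\<And>x. x \<in> A \<Longrightarrow> s \<le> d x" "\<And>x. x \<in> B \<Longrightarrow> d x \<le> t" for A B s t
  proof (rule metric[of "s - t"])
    show "0 < s - t" using that by simp
    show "s - t \<le> dist x y" if "x \<in> A" "y \<in> B" for x y
      using d_lip[of x y] \<open>\<And>x. x \<in> A \<Longrightarrow> s \<le> d x\<close>[OF that(1)] \<open>\<And>x. x \<in> B \<Longrightarrow> d x \<le> t\<close>[OF that(2)]
      by linarith
  qed
  \<comment> \<open>Every second shell: these are pairwise separated, so their measures add up to at most \<open>f E\<close>.\<close>
  have alt: "(\<Sum>i<n. f (R (2 * i + p))) \<le> f (\<Union>i<n. R (2 * i + p))" for n p
  proof (induction n)
    case 0 show ?case by simp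
  next
    case (Suc n)
    let ?U = "\<Union>i<n. R (2 * i + p)"
    have "(\<Sum>i<Suc n. f (R (2 * i + p))) \<le> f ?U + f (R (2 * n + p))"
      using Suc by (simp add: add_right_mono)
    also have "\<dots> \<le> f (?U \<union> R (2 * n + p))"
    proof (cases "n = 0")
      case False
      show ?thesis
      proof (rule sep)
        show "a (2 * n + p) < a (2 * n + p - 1)"
          using astrict[of "2 * n + p - 1"] False by simp
        show "d x \<le> a (2 * n + p)" if "x \<in> R (2 * n + p)" for x
          using that by (simp add: R_def)
        show "a (2 * n + p - 1) \<le> d x" if "x \<in> ?U" for x
        proof -
          from that obtain i where i: "i < n" "x \<in> R (2 * i + p)" by auto
          then have "a (2 * n + p - 1) \<le> a (Suc (2 * i + p))" by (intro amono) auto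
          with i show ?thesis by (simp add: R_def)
        qed
      qed
    qed (simp add: f0)
    also have "?U \<union> R (2 * n + p) = (\<Union>i<Suc n. R (2 * i + p))"
      by (auto simp: lessThan_Suc)
    finally show ?case .
  qed
  have fin: "(\<Sum>i. f (R i)) \<noteq> \<infinity>"
  proof -
    have "(\<Sum>i<n. f (R i)) \<le> f E + f E" for n
    proof -
      have "(\<Sum>i<n. f (R i)) \<le> (\<Sum>i<2 * n. f (R i))"
        by (rule sum_mono2) auto
      also have "\<dots> = (\<Sum>i<n. f (R (2 * i + 0))) + (\<Sum>i<n. f (R (2 * i + 1)))"
        by (induction n) (simp_all add: algebra_simps)
      also have "\<dots> \<le> f E + f E"
        by (intro add_mono order_trans[OF alt] mono) (auto simp: R_def)
      finally show ?thesis .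
    qed
    then have "(\<Sum>i. f (R i)) \<le> f E + f E"
      by (intro suminf_le_const) auto
    then show ?thesis
      using False by (metis ennreal_add_eq_top infinity_ennreal_def top.extremum_unique)
  qed
  \<comment> \<open>The missing tail is expressed by adding the initial segment on the left and the whole series
      on the right; this avoids subtraction in \<open>ennreal\<close>.\<close>
  have key: "(f (E \<inter> F) + f (E - F)) + (\<Sum>i<j. f (R i)) \<le> f E + (\<Sum>i. f (R i))" for j
  proof -
    have "E - F \<subseteq> S j \<union> (\<Union>i. R (i + j))"
    proof
      fix x assume x: "x \<in> E - F"
      show "x \<in> S j \<union> (\<Union>i. R (i + j))"
      proof (cases "a j \<le> d x")
        case False
        obtain m where m: "inverse (real (Suc m)) < d x"
          using reals_Archimedean[OF dpos[of x]] x by auto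
        define k where "k = (LEAST k. a k \<le> d x)"
        have "a m \<le> d x" using m by (simp add: a_def field_simps)
        then have k: "a k \<le> d x" unfolding k_def by (rule LeastI)
        have "j < k"
          using False k amono[of k j] by (meson linorder_not_le order_trans)
        then have "\<not> a (k - 1) \<le> d x" unfolding k_def by (intro not_less_Least) (simp add: k_def[symmetric])
        then have "x \<in> R (k - 1 - j + j)"
          using \<open>j < k\<close> k x by (simp add: R_def)
        then show ?thesis by blast
      qed (use x in \<open>auto simp: S_def\<close>)
    qed
    then have "f (E - F) \<le> f (S j \<union> (\<Union>i. R (i + j)))" by (rule mono)
    also have "S j \<union> (\<Union>i. R (i + j)) = (\<Union>i. case i of 0 \<Rightarrow> S j | Suc i \<Rightarrow> R (i + j))"
      by (auto split: nat.splits)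
    also have "f \<dots> \<le> (\<Sum>i. f (case i of 0 \<Rightarrow> S j | Suc i \<Rightarrow> R (i + j)))"
    proof (rule subadd, unfold disjoint_family_on_def, safe)
      have R_disj: "R m \<inter> R n = {}" if "m < n" for m n
        using amono[of "Suc m" n] that by (force simp: R_def)
      have S_disj: "S j \<inter> R (i + j) = {}" for i
        using amono[of j "i + j"] by (force simp: R_def S_def)
      fix m n :: nat and x
      assume "m \<noteq> n" "x \<in> (case m of 0 \<Rightarrow> S j | Suc i \<Rightarrow> R (i + j))"
        "x \<in> (case n of 0 \<Rightarrow> S j | Suc i \<Rightarrow> R (i + j))"
      then show "x \<in> {}"
        using S_disj R_disj by (auto split: nat.splits) (metis IntI add_less_cancel_right empty_iff linorder_neqE_nat)+
    qed
    also have "\<dots> = f (S j) + (\<Sum>i. f (R (i + j)))"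
      by (subst suminf_offset[of _ 1]) (auto simp: add.commute)
    finally have "(f (E \<inter> F) + f (E - F)) + (\<Sum>i<j. f (R i))
        \<le> (f (E \<inter> F) + (f (S j) + (\<Sum>i. f (R (i + j))))) + (\<Sum>i<j. f (R i))"
      by (intro add_mono order_refl)
    also have "\<dots> = (f (S j) + f (E \<inter> F)) + (\<Sum>i. f (R i))"
      by (subst suminf_offset[of "\<lambda>i. f (R i)" j]) (auto simp: ac_simps)
    also have "f (S j) + f (E \<inter> F) \<le> f (S j \<union> (E \<inter> F))"
      by (rule sep[OF apos[of j]]) (auto simp: S_def d_def)
    also have "\<dots> \<le> f E" by (rule mono) (auto simp: S_def)
    finally show ?thesis by (simp add: add_right_mono)
  qed
  have "(f (E \<inter> F) + f (E - F)) + (\<Sum>i. f (R i)) \<le> f E + (\<Sum>i. f (R i))"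
  proof -
    have "(f (E \<inter> F) + f (E - F)) + (\<Sum>i. f (R i))
        = (SUP j. (f (E \<inter> F) + f (E - F)) + (\<Sum>i<j. f (R i)))"
      by (simp add: suminf_eq_SUP ennreal_SUP_add_right)
    also have "\<dots> \<le> f E + (\<Sum>i. f (R i))"
      by (rule SUP_least) (rule key)
    finally show ?thesis .
  qed
  with fin show ?thesis
    by (simp add: add.commute[of _ "\<Sum>i. f (R i)"] ennreal_add_left_cancel_le)
qed

lemma metric_outer_measure_borel:
  fixes f :: "'a::metric_space set \<Rightarrow> ennreal"
  assumes om: "outer_measure_space UNIV f"
    and metric: "\<And>A B d. \<lbrakk>0 < d; \<And>x y. \<lbrakk>x \<in> A; y \<in> B\<rbrakk> \<Longrightarrow> d \<le> dist x y\<rbrakk> \<Longrightarrow> f A + f B \<le> f (A \<union> B)"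
  shows "measure_space UNIV (sets borel) f"
proof -
  interpret P: sigma_algebra UNIV "UNIV :: 'a set set"
    using sigma_algebra_Pow[of "UNIV :: 'a set"] by simp
  let ?L = "lambda_system UNIV UNIV f"
  have L: "measure_space UNIV ?L f"
    by (rule P.caratheodory_lemma[OF om])
  then have L_sa: "sigma_algebra UNIV ?L" by (simp add: measure_space_def)
  have "F \<in> ?L" if "closed F" for F
  proof -
    have "f E \<le> f (E \<inter> F) + f (E - F)" for E
    proof -
      have "subadditive UNIV f"
        using om P.countably_subadditive_subadditive by (simp add: outer_measure_space_def)
      moreover have "(E \<inter> F) \<inter> (E - F) = {}" "(E \<inter> F) \<union> (E - F) = E"
        by blast+
      ultimately show ?thesis
        using subadditiveD[of UNIV f "E \<inter> F" "E - F"] by simp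
    qed
    with metric_outer_measure_closed[OF om metric that] show ?thesis
      unfolding P.lambda_system_eq by (auto intro!: antisym)
  qed
  then have "sets (borel :: 'a measure) \<subseteq> ?L"
    unfolding borel_eq_closed
    using sigma_algebra.sigma_sets_subset[OF L_sa, of "Collect closed"] by auto
  from measure_down[OF L _ this] show ?thesis
    using sets.sigma_algebra_axioms[of "borel :: 'a measure"] by simp
qed

section \<open>Hausdorff measure\<close>

definition hausdorff_cost :: "nat \<Rightarrow> 'a::metric_space set \<Rightarrow> ennreal" where
  "hausdorff_cost k S = (if S = {} then 0 else ennreal (diameter S ^ k))"

lemma hausdorff_cost_empty [simp]: "hausdorff_cost k {} = 0"
  by (simp add: hausdorff_cost_def)

lemma hausdorff_pre_eq:
  "hausdorff_pre k d A =
     (INF C \<in> {C. A \<subseteq> (\<Union>i. C i) \<and> (\<forall>i. bounded (C i) \<and> diameter (C i) \<le> d)}. \<Sum>i. hausdorff_cost k (C i))"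
  by (simp add: hausdorff_pre_def hausdorff_cost_def)

lemma hausdorff_pre_le:
  assumes "A \<subseteq> (\<Union>i. C i)" "\<And>i. bounded (C i)" "\<And>i. diameter (C i) \<le> d"
  shows "hausdorff_pre k d A \<le> (\<Sum>i. hausdorff_cost k (C i))"
  unfolding hausdorff_pre_eq using assms by (intro INF_lower) auto

lemma hausdorff_pre_mono: "A \<subseteq> B \<Longrightarrow> hausdorff_pre k d A \<le> hausdorff_pre k d B"
  unfolding hausdorff_pre_eq by (intro INF_superset_mono) auto

lemma hausdorff_pre_antimono: "d \<le> d' \<Longrightarrow> hausdorff_pre k d' A \<le> hausdorff_pre k d A"
  unfolding hausdorff_pre_eq by (intro INF_superset_mono) (auto intro: order_trans)

lemma hausdorff_pre_less_cover:
  assumes "hausdorff_pre k d A < e"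
  obtains C where "A \<subseteq> (\<Union>i. C i)" "\<And>i::nat. bounded (C i)" "\<And>i. diameter (C i) \<le> d"
    "(\<Sum>i. hausdorff_cost k (C i)) < e"
proof -
  from assms obtain C where
    "C \<in> {C. A \<subseteq> (\<Union>i::nat. C i) \<and> (\<forall>i. bounded (C i) \<and> diameter (C i) \<le> d)}"
    "(\<Sum>i. hausdorff_cost k (C i)) < e"
    unfolding hausdorff_pre_eq INF_less_iff by (rule bexE)
  then show ?thesis by (intro that[of C]) auto
qed

lemma hausdorff_pre_empty: "0 \<le> d \<Longrightarrow> hausdorff_pre k d {} = 0"
  using hausdorff_pre_le[of "{}" "\<lambda>_. {}" d k] by simp

lemma hausdorff_pre_le_outer: "0 < d \<Longrightarrow> hausdorff_pre k d A \<le> hausdorff_outer k A"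
  unfolding hausdorff_outer_def by (intro SUP_upper) auto

lemma hausdorff_pre_subadditive:
  fixes A :: "nat \<Rightarrow> 'a::metric_space set"
  shows "hausdorff_pre k d (\<Union>n. A n) \<le> (\<Sum>n. hausdorff_pre k d (A n))"
proof (rule ennreal_le_epsilon)
  fix e :: real assume e: "0 < e" "(\<Sum>n. hausdorff_pre k d (A n)) < top"
  then have *: "\<And>n. hausdorff_pre k d (A n) < hausdorff_pre k d (A n) + e * (1/2)^Suc n"
    by (auto simp add: less_top dest!: ennreal_suminf_lessD)
  have "\<exists>B. A n \<subseteq> (\<Union>i::nat. B i) \<and> (\<forall>i. bounded (B i)) \<and> (\<forall>i. diameter (B i) \<le> d)
      \<and> (\<Sum>i. hausdorff_cost k (B i)) \<le> hausdorff_pre k d (A n) + e * (1/2)^Suc n" for n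
    by (rule hausdorff_pre_less_cover[OF *[of n]]) (meson less_imp_le)
  then obtain B where B: "\<And>n. A n \<subseteq> (\<Union>i::nat. B n i)" "\<And>n i. bounded (B n i)"
      "\<And>n i. diameter (B n i) \<le> d"
      and Ble: "\<And>n. (\<Sum>i. hausdorff_cost k (B n i)) \<le> hausdorff_pre k d (A n) + e * (1/2)^Suc n"
    by metis
  define C where "C = case_prod B o prod_decode"
  have "(\<Union>n. A n) \<subseteq> (\<Union>i. C i)"
    using B(1) by (auto simp add: C_def subset_eq) (metis prod.case prod_encode_inverse)
  then have "hausdorff_pre k d (\<Union>n. A n) \<le> (\<Sum>i. hausdorff_cost k (C i))"
    using B by (intro hausdorff_pre_le) (auto simp: C_def split_beta)
  also have "\<dots> = (\<Sum>n. \<Sum>i. hausdorff_cost k (B n i))"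
    unfolding C_def comp_def
    using suminf_ennreal_2dimen[of _ "\<lambda>p. hausdorff_cost k (case_prod B p)"] by simp
  also have "\<dots> \<le> (\<Sum>n. hausdorff_pre k d (A n) + e * (1/2) ^ Suc n)"
    by (intro suminf_le allI Ble) auto
  also have "... = (\<Sum>n. hausdorff_pre k d (A n)) + (\<Sum>n. ennreal e * ennreal ((1/2) ^ Suc n))"
    using \<open>0 < e\<close> by (subst suminf_add[symmetric])
                     (auto simp del: ennreal_suminf_cmult simp add: ennreal_mult[symmetric])
  also have "\<dots> = (\<Sum>n. hausdorff_pre k d (A n)) + e"
    unfolding ennreal_suminf_cmult
    by (subst suminf_ennreal_eq[OF zero_le_power power_half_series]) auto
  finally show "hausdorff_pre k d (\<Union>n. A n) \<le> (\<Sum>n. hausdorff_pre k d (A n)) + e" .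
qed

lemma hausdorff_outer_mono: "A \<subseteq> B \<Longrightarrow> hausdorff_outer k A \<le> hausdorff_outer k B"
  unfolding hausdorff_outer_def by (intro SUP_mono) (auto intro: hausdorff_pre_mono)

lemma outer_measure_space_hausdorff: "outer_measure_space UNIV (hausdorff_outer k)"
proof -
  have "hausdorff_outer k (\<Union>n. A n) \<le> (\<Sum>n. hausdorff_outer k (A n))" for A :: "nat \<Rightarrow> 'a set"
    unfolding hausdorff_outer_def[of k "\<Union>n. A n"]
  proof (rule SUP_least)
    fix d :: real assume "d \<in> {0<..}"
    then have "(\<Sum>n. hausdorff_pre k d (A n)) \<le> (\<Sum>n. hausdorff_outer k (A n))"
      by (intro suminf_le hausdorff_pre_le_outer) auto
    with hausdorff_pre_subadditive show "hausdorff_pre k d (\<Union>n. A n) \<le> (\<Sum>n. hausdorff_outer k (A n))"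
      by (rule order_trans)
  qed
  moreover have "hausdorff_outer k ({} :: 'a set) = 0"
    unfolding hausdorff_outer_def by (simp add: hausdorff_pre_empty)
  ultimately show ?thesis
    by (auto simp: outer_measure_space_def positive_def increasing_def countably_subadditive_def
        hausdorff_outer_mono)
qed

text \<open>
Covers by sets of diameter below the distance of the two sets split into a cover of each.
\<close>

lemma hausdorff_outer_separated:
  fixes A B :: "'a::metric_space set"
  assumes "0 < e" and sep: "\<And>x y. \<lbrakk>x \<in> A; y \<in> B\<rbrakk> \<Longrightarrow> e \<le> dist x y"
  shows "hausdorff_outer k A + hausdorff_outer k B \<le> hausdorff_outer k (A \<union> B)"
proof -
  have *: "hausdorff_pre k d A + hausdorff_pre k d B \<le> hausdorff_pre k d (A \<union> B)"
    if d: "d < e" for d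
    unfolding hausdorff_pre_eq[of k d "A \<union> B"]
  proof (rule INF_greatest, elim CollectE conjE)
    fix C :: "nat \<Rightarrow> 'a set"
    assume AB: "A \<union> B \<subseteq> (\<Union>i. C i)" and C': "\<forall>i. bounded (C i) \<and> diameter (C i) \<le> d"
    then have C: "A \<subseteq> (\<Union>i. C i)" "B \<subseteq> (\<Union>i. C i)" "\<And>i. bounded (C i)" "\<And>i. diameter (C i) \<le> d"
      by auto
    \<comment> \<open>Each member of the cover is too small to meet both sets.\<close>
    have no: "C i \<inter> A = {} \<or> C i \<inter> B = {}" for i
    proof (rule ccontr)
      assume "\<not> ?thesis"
      then obtain x y where xy: "x \<in> C i" "x \<in> A" "y \<in> C i" "y \<in> B" by blast
      have "dist x y \<le> d"
        using diameter_bounded_bound[OF C(3) xy(1,3)] C(4)[of i] by linarith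
      with sep[OF xy(2,4)] d show False by linarith
    qed
    have "0 \<le> d" using diameter_ge_0[OF C(3)[of 0]] C(4)[of 0] by linarith
    have part: "hausdorff_pre k d X \<le> (\<Sum>i. if C i \<inter> X = {} then 0 else hausdorff_cost k (C i))"
      if "X \<subseteq> (\<Union>i. C i)" for X
    proof -
      have "hausdorff_pre k d X \<le> (\<Sum>i. hausdorff_cost k (if C i \<inter> X = {} then {} else C i))"
      proof (rule hausdorff_pre_le)
        show "X \<subseteq> (\<Union>i. if C i \<inter> X = {} then {} else C i)"
        proof
          fix x assume "x \<in> X"
          with that obtain i where "x \<in> C i" by blast
          with \<open>x \<in> X\<close> show "x \<in> (\<Union>i. if C i \<inter> X = {} then {} else C i)" by auto
        qed
      qed (use C(3,4) \<open>0 \<le> d\<close> in auto)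
      also have "\<dots> = (\<Sum>i. if C i \<inter> X = {} then 0 else hausdorff_cost k (C i))"
        by (intro arg_cong[where f = suminf]) auto
      finally show ?thesis .
    qed
    have "hausdorff_pre k d A + hausdorff_pre k d B
        \<le> (\<Sum>i. (if C i \<inter> A = {} then 0 else hausdorff_cost k (C i))
              + (if C i \<inter> B = {} then 0 else hausdorff_cost k (C i)))"
      using part[OF C(1)] part[OF C(2)] by (subst suminf_add[symmetric]) (auto intro: add_mono)
    also have "\<dots> \<le> (\<Sum>i. hausdorff_cost k (C i))"
      using no by (intro suminf_le) auto
    finally show "hausdorff_pre k d A + hausdorff_pre k d B \<le> (\<Sum>i. hausdorff_cost k (C i))" .
  qed
  have "hausdorff_pre k d A + hausdorff_pre k d' B \<le> hausdorff_outer k (A \<union> B)"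
    if "0 < d" "0 < d'" for d d'
  proof -
    define m where "m = min (min d d') (e / 2)"
    have m: "m \<le> d" "m \<le> d'" "0 < m" "m < e"
      using that \<open>0 < e\<close> by (auto simp: m_def)
    have "hausdorff_pre k d A + hausdorff_pre k d' B \<le> hausdorff_pre k m A + hausdorff_pre k m B"
      using m by (intro add_mono hausdorff_pre_antimono)
    also have "\<dots> \<le> hausdorff_pre k m (A \<union> B)" using m by (intro *)
    also have "\<dots> \<le> hausdorff_outer k (A \<union> B)" using m by (intro hausdorff_pre_le_outer)
    finally show ?thesis .
  qed
  then show ?thesis
    unfolding hausdorff_outer_def[of k A] hausdorff_outer_def[of k B]
    by (simp add: ennreal_SUP_add_left[symmetric] ennreal_SUP_add_right SUP_le_iff)
qed

lemma measure_space_hausdorff_outer: "measure_space UNIV (sets borel) (hausdorff_outer k)"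
  by (rule metric_outer_measure_borel[OF outer_measure_space_hausdorff hausdorff_outer_separated])

lemma hausdorff_outer_contraction:
  fixes f :: "'a::metric_space \<Rightarrow> 'b::metric_space"
  assumes f: "\<And>x y. dist (f x) (f y) \<le> dist x y"
  shows "hausdorff_outer k (f ` A) \<le> hausdorff_outer k A"
  unfolding hausdorff_outer_def
proof (rule SUP_mono)
  fix d :: real assume d: "d \<in> {0<..}"
  have dia: "bounded (f ` S)" "diameter (f ` S) \<le> diameter S" if "bounded S" for S
  proof -
    show "bounded (f ` S)"
      using that f unfolding bounded_def by (metis (mono_tags, opaque_lifting) imageE order_trans)
    show "diameter (f ` S) \<le> diameter S"
    proof (cases "S = {}")
      case False
      have "dist (f x) (f y) \<le> diameter S" if "x \<in> S" "y \<in> S" for x y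
        using f[of x y] diameter_bounded_bound[OF \<open>bounded S\<close> that] by linarith
      with False show ?thesis
        unfolding diameter_def[of "f ` S"] by (auto intro!: cSUP_least)
    qed simp
  qed
  have "hausdorff_pre k d (f ` A) \<le> hausdorff_pre k d A"
    unfolding hausdorff_pre_eq[of k d A]
  proof (rule INF_greatest, elim CollectE conjE)
    fix C :: "nat \<Rightarrow> 'a set"
    assume A: "A \<subseteq> (\<Union>i. C i)" and C': "\<forall>i. bounded (C i) \<and> diameter (C i) \<le> d"
    then have C: "\<And>i. bounded (C i)" "\<And>i. diameter (C i) \<le> d"
      by auto
    have "hausdorff_pre k d (f ` A) \<le> (\<Sum>i. hausdorff_cost k (f ` C i))"
    proof (rule hausdorff_pre_le)
      show "f ` A \<subseteq> (\<Union>i. f ` C i)" using A by blast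
      show "diameter (f ` C i) \<le> d" for i
        using dia(2)[OF C(1)[of i]] C(2)[of i] by linarith
    qed (rule dia(1)[OF C(1)])
    also have "\<dots> \<le> (\<Sum>i. hausdorff_cost k (C i))"
    proof (intro suminf_le)
      show "hausdorff_cost k (f ` C i) \<le> hausdorff_cost k (C i)" for i
        using dia[OF C(1)[of i]]
        by (auto simp: hausdorff_cost_def intro!: ennreal_leI power_mono diameter_ge_0)
    qed auto
    finally show "hausdorff_pre k d (f ` A) \<le> (\<Sum>i. hausdorff_cost k (C i))" .
  qed
  with d show "\<exists>m\<in>{0<..}. hausdorff_pre k d (f ` A) \<le> hausdorff_pre k m A" by blast
qed

lemma hausdorff_outer_isometry:
  fixes f :: "'a::metric_space \<Rightarrow> 'b::metric_space"
  assumes f: "\<And>x y. dist (f x) (f y) = dist x y" and "surj f"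
  shows "hausdorff_outer k (f ` A) = hausdorff_outer k A"
proof (rule antisym)
  show "hausdorff_outer k (f ` A) \<le> hausdorff_outer k A"
    using f by (intro hausdorff_outer_contraction) simp
  have "inj f" using f by (metis dist_eq_0_iff injI)
  then have "A = inv f ` f ` A" by (simp add: image_inv_f_f)
  also have "hausdorff_outer k \<dots> \<le> hausdorff_outer k (f ` A)"
    using f \<open>surj f\<close> by (intro hausdorff_outer_contraction) (metis order_refl surj_f_inv_f)
  finally show "hausdorff_outer k A \<le> hausdorff_outer k (f ` A)" .
qed

lemma hausdorff_pre_finite_cover_le:
  fixes C :: "'i \<Rightarrow> 'a::metric_space set"
  assumes "finite I" "A \<subseteq> (\<Union>i\<in>I. C i)" "0 < d"
    "\<And>i. i \<in> I \<Longrightarrow> bounded (C i)" "\<And>i. i \<in> I \<Longrightarrow> diameter (C i) \<le> d"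
  shows "hausdorff_pre k d A \<le> of_nat (card I) * ennreal (d ^ k)"
proof -
  obtain h where h: "bij_betw h {..<card I} I"
    using \<open>finite I\<close> ex_bij_betw_nat_finite[OF \<open>finite I\<close>] by (auto simp: atLeast0LessThan)
  define D where "D n = (if n < card I then C (h n) else {})" for n
  have hI: "h n \<in> I" if "n < card I" for n using h that by (auto simp: bij_betw_def)
  have "A \<subseteq> (\<Union>n. D n)"
  proof
    fix x assume "x \<in> A"
    with assms(2) obtain i where "i \<in> I" "x \<in> C i" by auto
    moreover from this h obtain n where "n < card I" "h n = i"
      unfolding bij_betw_def by (metis imageE lessThan_iff)
    ultimately show "x \<in> (\<Union>n. D n)" by (auto simp: D_def intro!: exI[of _ n])
  qed
  then have "hausdorff_pre k d A \<le> (\<Sum>n. hausdorff_cost k (D n))"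
    using assms hI by (intro hausdorff_pre_le) (auto simp: D_def)
  also have "\<dots> = (\<Sum>n<card I. hausdorff_cost k (D n))"
    by (rule suminf_finite) (auto simp: D_def)
  also have "\<dots> \<le> (\<Sum>n<card I. ennreal (d ^ k))"
    using assms hI by (intro sum_mono) (auto simp: D_def hausdorff_cost_def intro!: ennreal_leI power_mono diameter_ge_0)
  finally show ?thesis by simp
qed

text \<open>
A grid with \<open>N\<close> steps per direction covers \<open>A\<close> by \<open>N ^ k\<close> cells of diameter at most a constant
over \<open>N\<close>, where \<open>k\<close> is the dimension of the hyperplane. The total cost is then bounded
independently of \<open>N\<close>.
\<close>

lemma hausdorff_outer_coordinate_hyperplane_finite:
  fixes A :: "'a::euclidean_space set"
  assumes b: "b \<in> Basis" and "bounded A" and A: "\<And>x. x \<in> A \<Longrightarrow> x \<bullet> b = 0"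
  shows "hausdorff_outer (DIM('a) - 1) A < \<infinity>"
proof -
  define k where "k = DIM('a) - 1"
  obtain L where L: "0 < L" "\<And>x. x \<in> A \<Longrightarrow> norm x < L"
    using \<open>bounded A\<close> by (metis bounded_pos_less)
  have coord: "\<bar>x \<bullet> i\<bar> < L" if "x \<in> A" "i \<in> Basis" for x i
    using L(2)[OF that(1)] Basis_le_norm[OF that(2), of x] by linarith
  have "hausdorff_pre k d A \<le> ennreal ((2 * L * DIM('a)) ^ k)" if "0 < d" for d
  proof -
    define N where "N = Suc (nat \<lceil>2 * L * DIM('a) / d\<rceil>)"
    define e where "e = 2 * L * DIM('a) / N"
    have N: "0 < N" by (simp add: N_def)
    have "2 * L * DIM('a) / d \<le> N" unfolding N_def by linarith
    then have ed: "e \<le> d" using \<open>0 < d\<close> N by (simp add: e_def field_simps)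
    have e0: "0 < e" using L N by (simp add: e_def)
    let ?I = "(Basis - {b}) \<rightarrow>\<^sub>E {..<N}"
    define C where "C g = {x :: 'a. x \<bullet> b = 0 \<and>
      (\<forall>i\<in>Basis - {b}. L * (2 * real (g i) / N - 1) \<le> x \<bullet> i \<and> x \<bullet> i \<le> L * (2 * real (g i + 1) / N - 1))}"
      for g :: "'a \<Rightarrow> nat"
    have near: "dist x y \<le> e" if "x \<in> C g" "y \<in> C g" for x y g
    proof -
      have "\<bar>(x - y) \<bullet> i\<bar> \<le> 2 * L / N" if "i \<in> Basis" for i
      proof (cases "i = b")
        case False
        with that \<open>x \<in> C g\<close> \<open>y \<in> C g\<close>
        have "\<bar>x \<bullet> i - y \<bullet> i\<bar> \<le> L * (2 * real (g i + 1) / N - 1) - L * (2 * real (g i) / N - 1)"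
          unfolding C_def mem_Collect_eq by (smt (verit) Diff_iff singletonD)
        also have "\<dots> = 2 * L / N" by (simp add: field_simps add_divide_distrib)
        finally show ?thesis by (simp add: inner_diff_left)
      qed (use \<open>x \<in> C g\<close> \<open>y \<in> C g\<close> L in \<open>auto simp: C_def inner_diff_left\<close>)
      then have "(\<Sum>i\<in>Basis. \<bar>(x - y) \<bullet> i\<bar>) \<le> DIM('a) * (2 * L / N)"
        by (intro sum_bounded_above) auto
      then show ?thesis
        using norm_le_l1[of "x - y"] by (simp add: dist_norm e_def mult_ac)
    qed
    have "A \<subseteq> (\<Union>g\<in>?I. C g)"
    proof
      fix x assume x: "x \<in> A"
      define g where "g = restrict (\<lambda>i. nat \<lfloor>(x \<bullet> i + L) * N / (2 * L)\<rfloor>) (Basis - {b})"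
      have g: "real (g i) \<le> (x \<bullet> i + L) * N / (2 * L)" "(x \<bullet> i + L) * N / (2 * L) \<le> real (g i + 1)" "g i < N"
        if "i \<in> Basis - {b}" for i
      proof -
        have i: "- L < x \<bullet> i" "x \<bullet> i < L" using coord[of x i] x that by auto
        let ?q = "(x \<bullet> i + L) * N / (2 * L)"
        have "(x \<bullet> i + L) * N < (2 * L) * N"
          using i N by (intro mult_strict_right_mono) auto
        then have q: "0 \<le> ?q" "?q < N" using i L(1) by (auto simp: pos_divide_less_eq mult.commute)
        have gi: "g i = nat \<lfloor>?q\<rfloor>" using that by (simp add: g_def)
        show "real (g i) \<le> ?q" "?q \<le> real (g i + 1)" "g i < N"
          unfolding gi using q by linarith+
      qed
      have "x \<in> C g"
        unfolding C_def using A[OF x] g L N by (auto simp: field_simps)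
      moreover have "g \<in> ?I" using g by (auto simp: g_def)
      ultimately show "x \<in> (\<Union>g\<in>?I. C g)" by blast
    qed
    moreover have "bounded (C g)" for g
      using near by (auto simp: bounded_two_points)
    moreover have "diameter (C g) \<le> e" for g
      using near e0 by (intro diameter_le) (auto simp: dist_norm)
    moreover have "finite ?I" by (intro finite_PiE) auto
    ultimately have "hausdorff_pre k e A \<le> of_nat (card ?I) * ennreal (e ^ k)"
      using e0 by (intro hausdorff_pre_finite_cover_le[where C = C]) auto
    also have "card ?I = N ^ k" using b by (simp add: card_PiE k_def)
    also have "of_nat (N ^ k) * ennreal (e ^ k) = ennreal ((2 * L * DIM('a)) ^ k)"
      using L(1) N by (simp add: e_def ennreal_of_nat_eq_real_of_nat ennreal_mult[symmetric] power_divide)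
    finally show ?thesis using hausdorff_pre_antimono[OF ed, of k A] by (rule order_trans[rotated])
  qed
  then have "hausdorff_outer k A \<le> ennreal ((2 * L * DIM('a)) ^ k)"
    unfolding hausdorff_outer_def by (intro SUP_least) auto
  then show ?thesis unfolding k_def by (metis ennreal_less_top infinity_ennreal_def order_le_less_trans)
qed

lemma coord_unit_cube_hyperplane:
  obtains b :: "'a::euclidean_space" where "b \<in> Basis"
    "coord_unit_cube (DIM('a) - 1) = {x. x \<bullet> b = 0 \<and> (\<forall>i\<in>Basis - {b}. 0 \<le> x \<bullet> i \<and> x \<bullet> i \<le> 1)}"
proof -
  define B :: "'a set" where "B = (SOME B. B \<subseteq> Basis \<and> card B = DIM('a) - 1)"
  obtain c :: 'a where "c \<in> Basis" using nonempty_Basis by blast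
  then have "\<exists>B. B \<subseteq> (Basis :: 'a set) \<and> card B = DIM('a) - 1"
    by (intro exI[of _ "Basis - {c}"]) auto
  then have "B \<subseteq> Basis \<and> card B = DIM('a) - 1" unfolding B_def by (rule someI_ex)
  then have "card (Basis - B) = 1" "B \<subseteq> Basis"
    using DIM_positive[where 'a = 'a] by (auto simp: card_Diff_subset finite_subset)
  then obtain b where b: "Basis - B = {b}" by (auto simp: card_1_singleton_iff)
  with \<open>B \<subseteq> Basis\<close> have "b \<in> Basis" "B = Basis - {b}" by auto
  moreover have "coord_unit_cube (DIM('a) - 1) = {x. (\<forall>i\<in>B. 0 \<le> x \<bullet> i \<and> x \<bullet> i \<le> 1) \<and> (\<forall>i\<in>Basis - B. x \<bullet> i = 0)}"
    unfolding coord_unit_cube_def Let_def B_def ..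
  ultimately show ?thesis using b by (intro that[of b]) auto
qed

text \<open>
A set of diameter \<open>r\<close> in the hyperplane lies in a cube of side \<open>2 * r\<close>. Thickening a cover of the
unit cube of the hyperplane by the unit interval in the remaining direction \<open>b\<close> thus covers the
full unit cube by boxes of volume \<open>(2 * r) ^ k\<close>, whose volumes have sum at least 1. With the finiteness
of the same quantity, the normalising constant of the Hausdorff measure is a positive real number.
\<close>

lemma hausdorff_outer_coord_unit_cube_pos:
  "0 < hausdorff_outer (DIM('a) - 1) (coord_unit_cube (DIM('a) - 1) :: 'a::euclidean_space set)"
proof (rule ccontr)
  define k where "k = DIM('a) - 1"
  obtain b :: 'a where b: "b \<in> Basis" and
    cube: "coord_unit_cube k = {x. x \<bullet> b = 0 \<and> (\<forall>i\<in>Basis - {b}. 0 \<le> x \<bullet> i \<and> x \<bullet> i \<le> 1)}"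
    unfolding k_def by (rule coord_unit_cube_hyperplane)
  assume "\<not> ?thesis"
  then have "hausdorff_pre k 1 (coord_unit_cube k :: 'a set) = 0"
    using hausdorff_pre_le_outer[of 1 k "coord_unit_cube k :: 'a set"] by (simp add: k_def)
  then have "hausdorff_pre k 1 (coord_unit_cube k :: 'a set) < ennreal (1 / 2 ^ k)" by simp
  then obtain C :: "nat \<Rightarrow> 'a set" where C: "coord_unit_cube k \<subseteq> (\<Union>i. C i)"
    "\<And>i. bounded (C i)" "\<And>i. diameter (C i) \<le> 1" and small: "(\<Sum>i. hausdorff_cost k (C i)) < ennreal (1 / 2 ^ k)"
    by (rule hausdorff_pre_less_cover) (rule that)
  define c where "c i = (SOME x. x \<in> C i)" for i
  define E where "E i = (if C i = {} then {} else
     cbox (\<Sum>j\<in>Basis. (if j = b then 0 else c i \<bullet> j - diameter (C i)) *\<^sub>R j)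
          (\<Sum>j\<in>Basis. (if j = b then 1 else c i \<bullet> j + diameter (C i)) *\<^sub>R j))" for i
  have "cbox 0 One \<subseteq> (\<Union>i. E i)"
  proof
    fix x :: 'a assume x: "x \<in> cbox 0 One"
    define y where "y = x - (x \<bullet> b) *\<^sub>R b"
    have yb: "y \<bullet> b = 0" and yj: "\<And>j. j \<in> Basis \<Longrightarrow> j \<noteq> b \<Longrightarrow> y \<bullet> j = x \<bullet> j"
      using b by (auto simp: y_def inner_diff_left inner_Basis)
    have "y \<in> coord_unit_cube k"
      unfolding cube using x yb yj by (auto simp: mem_box)
    with C(1) obtain i where i: "y \<in> C i" by blast
    then have ci: "c i \<in> C i" unfolding c_def by (rule someI)
    have "\<bar>x \<bullet> j - c i \<bullet> j\<bar> \<le> diameter (C i)" if "j \<in> Basis" "j \<noteq> b" for j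
      using diameter_bounded_bound[OF C(2) i ci] Basis_le_norm[OF that(1), of "y - c i"] yj[OF that]
      by (simp add: dist_norm inner_diff_left)
    then have "x \<in> E i"
      using i x b by (auto simp: E_def mem_box abs_diff_le_iff)
    then show "x \<in> (\<Union>i. E i)" by blast
  qed
  then have "emeasure lborel (cbox 0 One :: 'a set) \<le> emeasure lborel (\<Union>i. E i)"
    by (intro emeasure_mono) (auto simp: E_def)
  also have "\<dots> \<le> (\<Sum>i. emeasure lborel (E i))"
    by (intro emeasure_subadditive_countably) (auto simp: E_def)
  also have "\<dots> = (\<Sum>i. ennreal (2 ^ k) * hausdorff_cost k (C i))"
  proof (intro arg_cong[where f = suminf] ext)
    fix i
    have "emeasure lborel (E i) = ennreal (\<Prod>j\<in>Basis. if j = b then 1 else 2 * diameter (C i))"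
      if "C i \<noteq> {}"
      using that diameter_ge_0[OF C(2)[of i]]
      by (auto simp: E_def emeasure_lborel_cbox_eq inner_diff_left intro!: arg_cong[where f = ennreal] prod.cong split: if_splits)
    also have "(\<Prod>j\<in>(Basis :: 'a set). if j = b then 1 else 2 * diameter (C i)) = (2 * diameter (C i)) ^ k"
      using b by (subst prod.remove[of _ b]) (auto simp: k_def)
    finally show "emeasure lborel (E i) = ennreal (2 ^ k) * hausdorff_cost k (C i)"
      using diameter_ge_0[OF C(2)[of i]]
      by (auto simp: hausdorff_cost_def E_def ennreal_mult[symmetric] power_mult_distrib)
  qed
  also have "\<dots> = ennreal (2 ^ k) * (\<Sum>i. hausdorff_cost k (C i))" by simp
  also have "\<dots> < ennreal (2 ^ k) * ennreal (1 / 2 ^ k)"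
    using small by (intro ennreal_mult_strict_left_mono) auto
  also have "\<dots> = 1" by (simp add: ennreal_mult[symmetric])
  finally show False by (simp add: emeasure_lborel_cbox_eq)
qed

lemma coord_unit_cube_eq_cbox_slice:
  obtains b :: "'a::euclidean_space" where "b \<in> Basis"
    "coord_unit_cube (DIM('a) - 1) = cbox 0 One \<inter> {x. x \<bullet> b = 0}"
proof -
  obtain b :: 'a where b: "b \<in> Basis" and
    cube: "coord_unit_cube (DIM('a) - 1) = {x. x \<bullet> b = 0 \<and> (\<forall>i\<in>Basis - {b}. 0 \<le> x \<bullet> i \<and> x \<bullet> i \<le> 1)}"
    by (rule coord_unit_cube_hyperplane)
  have "x \<in> cbox 0 One \<longleftrightarrow> 0 \<le> x \<bullet> b \<and> x \<bullet> b \<le> 1 \<and> (\<forall>i\<in>Basis - {b}. 0 \<le> x \<bullet> i \<and> x \<bullet> i \<le> 1)" for x :: 'a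
  proof -
    have "x \<in> cbox 0 One \<longleftrightarrow> (\<forall>i\<in>insert b (Basis - {b}). 0 \<le> x \<bullet> i \<and> x \<bullet> i \<le> 1)"
      unfolding insert_Diff[OF b] by (simp add: mem_box)
    then show ?thesis by (simp only: ball_simps(7) conj_assoc)
  qed
  then have "coord_unit_cube (DIM('a) - 1) = cbox 0 One \<inter> {x. x \<bullet> b = 0}"
    unfolding cube by auto
  with b show ?thesis by (rule that)
qed

lemma hausdorff_outer_coord_unit_cube_finite:
  "hausdorff_outer (DIM('a) - 1) (coord_unit_cube (DIM('a) - 1) :: 'a::euclidean_space set) < \<infinity>"
proof -
  obtain b :: 'a where b: "b \<in> Basis" and
    cube: "coord_unit_cube (DIM('a) - 1) = cbox 0 One \<inter> {x. x \<bullet> b = 0}"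
    by (rule coord_unit_cube_eq_cbox_slice)
  show ?thesis
    unfolding cube by (rule hausdorff_outer_coordinate_hyperplane_finite[OF b]) (auto intro: bounded_Int)
qed

lemma space_hausdorff_measure [simp]: "space (hausdorff_measure k) = UNIV"
  and sets_hausdorff_measure [simp, measurable_cong]: "sets (hausdorff_measure k) = sets borel"
  using sets.sigma_sets_eq[of borel] by (simp_all add: hausdorff_measure_def)

lemma emeasure_hausdorff_measure:
  fixes A :: "'a::euclidean_space set"
  assumes "A \<in> sets borel"
  shows "emeasure (hausdorff_measure k) A =
    hausdorff_outer k A / hausdorff_outer k (coord_unit_cube k :: 'a set)"
proof (rule emeasure_measure_of[OF hausdorff_measure_def])
  let ?c = "hausdorff_outer k (coord_unit_cube k :: 'a set)"
  note H = measure_space_hausdorff_outer[of k, where 'a = 'a, unfolded measure_space_def]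
  show "positive (sets (hausdorff_measure k)) (\<lambda>A :: 'a set. hausdorff_outer k A / ?c)"
    using H by (simp add: positive_def divide_ennreal_def)
  show "countably_additive (sets (hausdorff_measure k)) (\<lambda>A :: 'a set. hausdorff_outer k A / ?c)"
    unfolding countably_additive_def
  proof (intro allI impI)
    fix A :: "nat \<Rightarrow> 'a set"
    assume "range A \<subseteq> sets (hausdorff_measure k)" "disjoint_family A" "(\<Union>i. A i) \<in> sets (hausdorff_measure k)"
    then have "(\<Sum>i. hausdorff_outer k (A i)) = hausdorff_outer k (\<Union>i. A i)"
      using H unfolding countably_additive_def by simp
    then show "(\<Sum>i. hausdorff_outer k (A i) / ?c) = hausdorff_outer k (\<Union>i. A i) / ?c"
      by (simp add: divide_ennreal_def)
  qed
qed (use assms in auto)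

lemma emeasure_hausdorff_measure_isometry:
  fixes f :: "'a::euclidean_space \<Rightarrow> 'a"
  assumes f: "\<And>x y. dist (f x) (f y) = dist x y" and "surj f" and A: "A \<in> sets borel"
  shows "emeasure (hausdorff_measure k) (f -` A) = emeasure (hausdorff_measure k) A"
proof -
  have "continuous_on UNIV f"
    unfolding continuous_on_iff using f by auto
  then have "f -` A \<in> sets borel"
    using measurable_sets[OF borel_measurable_continuous_onI A, of f] by simp
  moreover have "hausdorff_outer k (f -` A) = hausdorff_outer k A"
    using hausdorff_outer_isometry[of f k "f -` A"] f \<open>surj f\<close> by (simp add: surj_image_vimage_eq)
  ultimately show ?thesis
    using A by (simp add: emeasure_hausdorff_measure)
qed

lemma emeasure_hausdorff_measure_coord_unit_cube:
  "emeasure (hausdorff_measure (DIM('a) - 1)) (coord_unit_cube (DIM('a) - 1) :: 'a::euclidean_space set) = 1"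
proof -
  obtain b :: 'a where "coord_unit_cube (DIM('a) - 1) = cbox 0 One \<inter> {x. x \<bullet> b = 0}"
    by (rule coord_unit_cube_eq_cbox_slice)
  then have "(coord_unit_cube (DIM('a) - 1) :: 'a set) \<in> sets borel" by simp
  from emeasure_hausdorff_measure[OF this] show ?thesis
    using hausdorff_outer_coord_unit_cube_pos[where 'a = 'a] hausdorff_outer_coord_unit_cube_finite[where 'a = 'a]
    by (simp add: ennreal_divide_self)
qed

section \<open>Slicing Lebesgue measure by parallel hyperplanes\<close>

text \<open>
Uniqueness of translation-invariant measures without approximation by boxes: the double integral
of \<open>indicator B y * indicator A (y + x)\<close> over \<open>x\<close> and \<open>y\<close> is
computed in two ways, using the invariance of \<open>M\<close> in one order and that of Lebesgue measure in
the other. For a symmetric \<open>B\<close> of positive finite volume the identity says that \<open>M\<close> is a multiple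
of Lebesgue measure.
\<close>

lemma translation_invariant_borel_measure_unique:
  fixes M :: "'a::euclidean_space measure"
  assumes M [measurable_cong]: "sets M = sets borel" and "sigma_finite_measure M"
    and inv: "\<And>A z. A \<in> sets borel \<Longrightarrow> emeasure M ((\<lambda>x. z + x) -` A) = emeasure M A"
    and A [measurable]: "A \<in> sets borel" and B [measurable]: "B \<in> sets borel"
  shows "emeasure M A * emeasure lborel B = emeasure lborel A * emeasure M (uminus -` B)"
proof -
  interpret M: sigma_finite_measure M by fact
  interpret pair_sigma_finite M "lborel :: 'a measure" ..
  have [simp]: "space M = UNIV" using sets_eq_imp_space_eq[OF M] by simp
  have [measurable]: "uminus -` B \<in> sets borel"
    using measurable_sets[OF borel_measurable_uminus[OF measurable_ident] B] by simp
  have shiftA: "(\<integral>\<^sup>+x. indicator A (y + x) \<partial>M) = emeasure M A" for y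
  proof -
    have [measurable]: "(\<lambda>x. y + x) -` A \<in> sets M"
      using measurable_sets[of "\<lambda>x. y + x" borel borel A] M by simp
    have "(\<integral>\<^sup>+x. indicator A (y + x) \<partial>M) = (\<integral>\<^sup>+x. indicator ((\<lambda>x. y + x) -` A) x \<partial>M)"
      by (simp add: indicator_def vimage_def)
    then show ?thesis using inv[OF A, of y] by simp
  qed
  have "emeasure M A * emeasure lborel B = (\<integral>\<^sup>+y. emeasure M A * indicator B y \<partial>lborel)"
    by (simp add: nn_integral_cmult)
  also have "\<dots> = (\<integral>\<^sup>+y. (\<integral>\<^sup>+x. indicator B y * indicator A (y + x) \<partial>M) \<partial>lborel)"
    by (simp add: nn_integral_cmult shiftA mult.commute)
  also have "\<dots> = (\<integral>\<^sup>+x. (\<integral>\<^sup>+y. indicator B y * indicator A (y + x) \<partial>lborel) \<partial>M)"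
    by (rule Fubini') measurable
  also have "\<dots> = (\<integral>\<^sup>+x. (\<integral>\<^sup>+y. indicator B (y - x) * indicator A y \<partial>lborel) \<partial>M)"
  proof (rule nn_integral_cong)
    fix x
    have "(\<integral>\<^sup>+y. indicator B (y - x) * indicator A y \<partial>lborel)
        = (\<integral>\<^sup>+y. indicator B (y - x) * indicator A y \<partial>(distr lborel borel ((+) x)))"
      by (simp add: lborel_distr_plus)
    also have "\<dots> = (\<integral>\<^sup>+y. indicator B y * indicator A (y + x) \<partial>lborel)"
      by (subst nn_integral_distr) (simp_all add: add.commute)
    finally show "(\<integral>\<^sup>+y. indicator B y * indicator A (y + x) \<partial>lborel)
      = (\<integral>\<^sup>+y. indicator B (y - x) * indicator A y \<partial>lborel)" ..
  qed
  also have "\<dots> = (\<integral>\<^sup>+y. (\<integral>\<^sup>+x. indicator B (y - x) * indicator A y \<partial>M) \<partial>lborel)"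
    by (rule Fubini'[symmetric]) measurable
  also have "\<dots> = (\<integral>\<^sup>+y. emeasure M (uminus -` B) * indicator A y \<partial>lborel)"
  proof (rule nn_integral_cong)
    fix y
    have "(\<integral>\<^sup>+x. indicator B (y - x) \<partial>M) = (\<integral>\<^sup>+x. indicator ((\<lambda>x. - y + x) -` uminus -` B) x \<partial>M)"
      by (simp add: indicator_def vimage_def)
    also have "\<dots> = emeasure M ((\<lambda>x. - y + x) -` uminus -` B)"
      using measurable_sets[of "\<lambda>x. - y + x" borel borel "uminus -` B"] M by simp
    also have "\<dots> = emeasure M (uminus -` B)" by (rule inv) simp
    finally show "(\<integral>\<^sup>+x. indicator B (y - x) * indicator A y \<partial>M) = emeasure M (uminus -` B) * indicator A y"
      by (simp add: nn_integral_multc)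
  qed
  also have "\<dots> = emeasure M (uminus -` B) * emeasure lborel A"
    by (subst nn_integral_cmult) auto
  finally show ?thesis by (simp only: mult.commute)
qed

text \<open>
All hyperplane directions carry the same Hausdorff measure, up to a rotation. The set \<open>S\<close> will be
a ball around the origin.
\<close>

lemma hausdorff_measure_rotate:
  fixes u v :: "real ^ 'n" and g :: "real ^ 'n \<Rightarrow> real ^ 'n"
  assumes "norm u = 1" "norm v = 1" and [measurable]: "S \<in> sets borel"
    and rot: "\<And>f. orthogonal_transformation f \<Longrightarrow> f -` S = S"
  shows "emeasure (hausdorff_measure k) (S \<inter> {x. x \<bullet> u = s}) = emeasure (hausdorff_measure k) (S \<inter> {x. x \<bullet> v = s})"
proof -
  obtain f where f: "orthogonal_transformation f" "f u = v"
    using orthogonal_transformation_exists_1[OF assms(1,2)] .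
  have "x \<bullet> u = f x \<bullet> v" for x
    using f by (metis orthogonal_transformation_def)
  then have "S \<inter> {x. x \<bullet> u = s} = f -` (S \<inter> {x. x \<bullet> v = s})"
    using rot[OF f(1)] by auto
  moreover have "surj f"
    using f(1) by (rule orthogonal_transformation_surj)
  ultimately show ?thesis
    using f(1) emeasure_hausdorff_measure_isometry[of f "S \<inter> {x. x \<bullet> v = s}"]
    by (simp add: orthogonal_transformation_isometry)
qed

lemma hausdorff_measure_hyperplane_cball_finite:
  fixes u :: "real ^ 'n"
  assumes "norm u = 1"
  shows "emeasure (hausdorff_measure (CARD('n) - 1)) (cball 0 r \<inter> {x. x \<bullet> u = 0}) < \<infinity>"
proof -
  obtain b :: "real ^ 'n" where b: "b \<in> Basis" using nonempty_Basis by blast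
  have "emeasure (hausdorff_measure (CARD('n) - 1)) (cball 0 r \<inter> {x. x \<bullet> u = 0})
      = emeasure (hausdorff_measure (CARD('n) - 1)) (cball 0 r \<inter> {x. x \<bullet> b = 0})"
    using assms b by (intro hausdorff_measure_rotate) (auto simp: orthogonal_transformation_norm)
  also have "\<dots> = hausdorff_outer (CARD('n) - 1) (cball 0 r \<inter> {x. x \<bullet> b = 0})
      / hausdorff_outer (CARD('n) - 1) (coord_unit_cube (CARD('n) - 1) :: (real ^ 'n) set)"
    by (rule emeasure_hausdorff_measure) simp
  also have "\<dots> < \<infinity>"
  proof -
    have "hausdorff_outer (DIM(real ^ 'n) - 1) (cball 0 r \<inter> {x. x \<bullet> b = 0}) < \<infinity>"
      by (rule hausdorff_outer_coordinate_hyperplane_finite[OF b]) (auto intro: bounded_Int)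
    then have "hausdorff_outer (CARD('n) - 1) (cball 0 r \<inter> {x. x \<bullet> b = 0}) < \<infinity>"
      by simp
    moreover have "0 < hausdorff_outer (CARD('n) - 1) (coord_unit_cube (CARD('n) - 1) :: (real ^ 'n) set)"
      using hausdorff_outer_coord_unit_cube_pos[where 'a = "real ^ 'n"] by simp
    ultimately show ?thesis
      unfolding divide_ennreal_def
      by (auto simp: ennreal_mult_less_top less_top[symmetric] ennreal_mult_eq_top_iff)
  qed
  finally show ?thesis .
qed

definition hyperplane_measure :: "real ^ 'n \<Rightarrow> (real ^ 'n) measure" where
  "hyperplane_measure u = density (hausdorff_measure (CARD('n) - 1)) (indicator {x. x \<bullet> u = 0})"

lemma sets_hyperplane_measure [simp, measurable_cong]: "sets (hyperplane_measure u) = sets borel"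
  and space_hyperplane_measure [simp]: "space (hyperplane_measure u) = UNIV"
  by (simp_all add: hyperplane_measure_def)

lemma emeasure_hyperplane_measure:
  "A \<in> sets borel \<Longrightarrow> emeasure (hyperplane_measure (u :: real ^ 'n)) A
     = emeasure (hausdorff_measure (CARD('n) - 1)) (A \<inter> {x. x \<bullet> u = 0})"
  unfolding hyperplane_measure_def by (subst emeasure_restricted) (auto simp: Int_commute)

lemma sigma_finite_hyperplane_measure:
  assumes "norm (u :: real ^ 'n) = 1"
  shows "sigma_finite_measure (hyperplane_measure u)"
proof (rule sigma_finite_measure.intro, intro exI[of _ "range (\<lambda>n. cball 0 (real n))"] conjI ballI)
  show "\<Union> (range (\<lambda>n. cball 0 (real n))) = space (hyperplane_measure u)"
    by (auto simp: real_arch_simple)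
  show "emeasure (hyperplane_measure u) a \<noteq> \<infinity>" if "a \<in> range (\<lambda>n. cball 0 (real n))" for a
    using that hausdorff_measure_hyperplane_cball_finite[OF assms]
    by (auto simp: emeasure_hyperplane_measure less_top)
qed auto

text \<open>
The measure that adds up the Hausdorff measures of the slices orthogonal to \<open>u\<close>. As the image of
a product measure it is countably additive from the start, and the measurability of the slice
areas comes with it.
\<close>

definition slice_measure :: "real ^ 'n \<Rightarrow> (real ^ 'n) measure" where
  "slice_measure u = distr (hyperplane_measure u \<Otimes>\<^sub>M lborel) borel (\<lambda>(x, s). x + s *\<^sub>R u)"

lemma hausdorff_measure_translate:
  fixes A :: "'a::euclidean_space set"
  assumes "A \<in> sets borel"
  shows "emeasure (hausdorff_measure k) ((\<lambda>x. z + x) -` A) = emeasure (hausdorff_measure k) A"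
  by (rule emeasure_hausdorff_measure_isometry[OF _ _ assms]) (auto intro: surj_plus)

lemma hyperplane_measure_section:
  fixes u :: "real ^ 'n"
  assumes u: "norm u = 1" and A [measurable]: "A \<in> sets borel"
  shows "emeasure (hyperplane_measure u) ((\<lambda>x. (x, s)) -` (\<lambda>(x, s). x + s *\<^sub>R u) -` A)
    = emeasure (hausdorff_measure (CARD('n) - 1)) (A \<inter> {x. x \<bullet> u = s})"
proof -
  have uu: "u \<bullet> u = 1" using u by (simp add: dot_square_norm)
  have T: "(\<lambda>x. (x, s)) -` (\<lambda>(x, s). x + s *\<^sub>R u) -` A = (\<lambda>x. s *\<^sub>R u + x) -` A"
    by (auto simp: add.commute)
  have "(\<lambda>x. s *\<^sub>R u + x) -` A \<in> sets borel"
    using measurable_sets[of "\<lambda>x. s *\<^sub>R u + x" borel borel A] by simp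
  from emeasure_hyperplane_measure[OF this]
  have "emeasure (hyperplane_measure u) ((\<lambda>x. s *\<^sub>R u + x) -` A)
    = emeasure (hausdorff_measure (CARD('n) - 1)) ((\<lambda>x. s *\<^sub>R u + x) -` A \<inter> {x. x \<bullet> u = 0})" .
  also have "(\<lambda>x. s *\<^sub>R u + x) -` A \<inter> {x. x \<bullet> u = 0} = (\<lambda>x. s *\<^sub>R u + x) -` (A \<inter> {x. x \<bullet> u = s})"
    using uu by (auto simp: inner_add_left)
  also have "emeasure (hausdorff_measure (CARD('n) - 1)) \<dots>
    = emeasure (hausdorff_measure (CARD('n) - 1)) (A \<inter> {x. x \<bullet> u = s})"
    by (rule hausdorff_measure_translate) simp
  finally show ?thesis unfolding T .
qed

lemma measurable_slicing_map:
  "(\<lambda>(x, s). x + s *\<^sub>R u) \<in> hyperplane_measure u \<Otimes>\<^sub>M lborel \<rightarrow>\<^sub>M borel"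
  by measurable

lemma emeasure_slice_measure:
  fixes u :: "real ^ 'n"
  assumes u: "norm u = 1" and A: "A \<in> sets borel"
  shows "emeasure (slice_measure u) A
       = (\<integral>\<^sup>+s. emeasure (hausdorff_measure (CARD('n) - 1)) (A \<inter> {x. x \<bullet> u = s}) \<partial>lborel)"
    and "(\<lambda>s. emeasure (hausdorff_measure (CARD('n) - 1)) (A \<inter> {x. x \<bullet> u = s})) \<in> borel_measurable lborel"
proof -
  interpret H: sigma_finite_measure "hyperplane_measure u"
    by (rule sigma_finite_hyperplane_measure[OF u])
  interpret pair_sigma_finite "hyperplane_measure u" "lborel :: real measure" ..
  let ?f = "\<lambda>(x, s). x + s *\<^sub>R u"
  have S: "?f -` A \<in> sets (hyperplane_measure u \<Otimes>\<^sub>M lborel)"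
    using measurable_sets[OF measurable_slicing_map A, of u] by (simp add: space_pair_measure)
  have "emeasure (slice_measure u) A = emeasure (hyperplane_measure u \<Otimes>\<^sub>M lborel) (?f -` A)"
    unfolding slice_measure_def
    by (subst emeasure_distr[OF measurable_slicing_map A]) (simp add: space_pair_measure)
  also have "\<dots> = (\<integral>\<^sup>+s. emeasure (hyperplane_measure u) ((\<lambda>x. (x, s)) -` ?f -` A) \<partial>lborel)"
    by (rule emeasure_pair_measure_alt2[OF S])
  finally show "emeasure (slice_measure u) A
       = (\<integral>\<^sup>+s. emeasure (hausdorff_measure (CARD('n) - 1)) (A \<inter> {x. x \<bullet> u = s}) \<partial>lborel)"
    unfolding hyperplane_measure_section[OF u A] .
  show "(\<lambda>s. emeasure (hausdorff_measure (CARD('n) - 1)) (A \<inter> {x. x \<bullet> u = s})) \<in> borel_measurable lborel"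
    using measurable_emeasure_Pair2[OF S] unfolding hyperplane_measure_section[OF u A] .
qed

lemma sets_slice_measure [simp, measurable_cong]: "sets (slice_measure u) = sets borel"
  and space_slice_measure [simp]: "space (slice_measure u) = UNIV"
  by (simp_all add: slice_measure_def)

lemma sigma_finite_slice_measure:
  assumes u: "norm (u :: real ^ 'n) = 1"
  shows "sigma_finite_measure (slice_measure u)"
proof (rule sigma_finite_measure.intro, intro exI[of _ "range (\<lambda>n. cball 0 (real n))"] conjI ballI)
  let ?H = "hausdorff_measure (CARD('n) - 1) :: (real ^ 'n) measure"
  show "\<Union> (range (\<lambda>n. cball 0 (real n))) = space (slice_measure u)"
    by (auto simp: real_arch_simple)
  fix a assume "a \<in> range (\<lambda>n. cball (0 :: real ^ 'n) (real n))"
  then obtain n where a: "a = cball 0 (real n)" by blast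
  have uu: "u \<bullet> u = 1" using u by (simp add: dot_square_norm)
  have "emeasure (slice_measure u) a = (\<integral>\<^sup>+s. emeasure ?H (a \<inter> {x. x \<bullet> u = s}) \<partial>lborel)"
    by (simp add: emeasure_slice_measure(1)[OF u] a)
  also have "\<dots> \<le> (\<integral>\<^sup>+s. emeasure ?H (cball 0 (2 * real n) \<inter> {x. x \<bullet> u = 0}) * indicator {- real n..real n} s \<partial>lborel)"
  proof (rule nn_integral_mono)
    fix s :: real
    show "emeasure ?H (a \<inter> {x. x \<bullet> u = s})
      \<le> emeasure ?H (cball 0 (2 * real n) \<inter> {x. x \<bullet> u = 0}) * indicator {- real n..real n} s"
    proof (cases "\<bar>s\<bar> \<le> real n")
      case True
      have "emeasure ?H (a \<inter> {x. x \<bullet> u = s}) = emeasure ?H ((\<lambda>x. s *\<^sub>R u + x) -` (a \<inter> {x. x \<bullet> u = s}))"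
        by (rule hausdorff_measure_translate[symmetric]) (simp add: a)
      also have "(\<lambda>x. s *\<^sub>R u + x) -` (a \<inter> {x. x \<bullet> u = s}) \<subseteq> cball 0 (2 * real n) \<inter> {x. x \<bullet> u = 0}"
      proof
        fix x assume "x \<in> (\<lambda>x. s *\<^sub>R u + x) -` (a \<inter> {x. x \<bullet> u = s})"
        then have x: "norm (s *\<^sub>R u + x) \<le> n" "x \<bullet> u = 0" using uu by (auto simp: a inner_add_left)
        have "norm x \<le> norm (s *\<^sub>R u + x) + norm (s *\<^sub>R u)"
          using norm_triangle_ineq4[of "s *\<^sub>R u + x" "s *\<^sub>R u"] by simp
        then show "x \<in> cball 0 (2 * real n) \<inter> {x. x \<bullet> u = 0}" using x True u by simp
      qed
      then have "emeasure ?H ((\<lambda>x. s *\<^sub>R u + x) -` (a \<inter> {x. x \<bullet> u = s})) \<le> emeasure ?H (cball 0 (2 * real n) \<inter> {x. x \<bullet> u = 0})"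
        by (rule emeasure_mono) auto
      finally show ?thesis using True by (simp add: indicator_def abs_le_iff)
    next
      case False
      have "\<bar>x \<bullet> u\<bar> \<le> norm x" for x using Cauchy_Schwarz_ineq2[of x u] u by simp
      then have "x \<notin> a" if "x \<bullet> u = s" for x
        using False that by (metis a dist_0_norm mem_cball order_trans)
      then have "a \<inter> {x. x \<bullet> u = s} = {}" by blast
      then show ?thesis by simp
    qed
  qed
  also have "\<dots> = emeasure ?H (cball 0 (2 * real n) \<inter> {x. x \<bullet> u = 0}) * ennreal (2 * real n)"
    by (simp add: nn_integral_cmult)
  also have "\<dots> < \<infinity>"
    using hausdorff_measure_hyperplane_cball_finite[OF u] by (simp add: ennreal_mult_less_top)
  finally show "emeasure (slice_measure u) a \<noteq> \<infinity>" by simp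
qed auto

lemma slice_measure_translation_invariant:
  fixes u :: "real ^ 'n"
  assumes u: "norm u = 1" and A [measurable]: "A \<in> sets borel"
  shows "emeasure (slice_measure u) ((\<lambda>x. z + x) -` A) = emeasure (slice_measure u) A"
proof -
  let ?H = "hausdorff_measure (CARD('n) - 1) :: (real ^ 'n) measure"
  have [measurable]: "(\<lambda>x. z + x) -` A \<in> sets borel"
    using measurable_sets[of "\<lambda>x. z + x" borel borel A] by simp
  have meas: "(\<lambda>s. emeasure ?H (A \<inter> {x. x \<bullet> u = s})) \<in> borel_measurable borel"
    using emeasure_slice_measure(2)[OF u A] by simp
  have "emeasure ?H ((\<lambda>x. z + x) -` A \<inter> {x. x \<bullet> u = s}) = emeasure ?H (A \<inter> {x. x \<bullet> u = z \<bullet> u + s})" for s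
  proof -
    have "(\<lambda>x. z + x) -` A \<inter> {x. x \<bullet> u = s} = (\<lambda>x. z + x) -` (A \<inter> {x. x \<bullet> u = z \<bullet> u + s})"
      by (auto simp: inner_add_left)
    then show ?thesis by (simp only:) (rule hausdorff_measure_translate, simp)
  qed
  then have "emeasure (slice_measure u) ((\<lambda>x. z + x) -` A)
      = (\<integral>\<^sup>+s. emeasure ?H (A \<inter> {x. x \<bullet> u = z \<bullet> u + s}) \<partial>lborel)"
    by (simp add: emeasure_slice_measure(1)[OF u])
  also have "\<dots> = (\<integral>\<^sup>+s. emeasure ?H (A \<inter> {x. x \<bullet> u = s}) \<partial>(distr lborel borel ((+) (z \<bullet> u))))"
    by (subst nn_integral_distr) (use meas in simp_all)
  also have "\<dots> = emeasure (slice_measure u) A"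
    by (simp add: emeasure_slice_measure(1)[OF u] lborel_distr_plus)
  finally show ?thesis .
qed

text \<open>
Cavalieri's principle for the normalised Hausdorff measure. Slicing in direction \<open>u\<close> gives a
translation-invariant measure, hence a multiple of Lebesgue measure. The factor is visible on the
unit ball, where rotation shows that it does not depend on \<open>u\<close>. For the coordinate direction
used by the normalising cube the factor is 1, because the slices of the unit cube are
translates of that cube.
\<close>

theorem lborel_slices:
  fixes u :: "real ^ 'n"
  assumes u: "norm u = 1" and A: "A \<in> sets borel"
  shows "emeasure lborel A
     = (\<integral>\<^sup>+s. emeasure (hausdorff_measure (CARD('n) - 1)) (A \<inter> {x. x \<bullet> u = s}) \<partial>lborel)"
proof -
  let ?H = "hausdorff_measure (CARD('n) - 1) :: (real ^ 'n) measure"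
  let ?B = "cball (0 :: real ^ 'n) 1"
  have unique: "emeasure (slice_measure v) A * emeasure lborel ?B = emeasure lborel A * emeasure (slice_measure v) ?B"
    if v: "norm v = 1" and A: "A \<in> sets borel" for v A
  proof -
    have "uminus -` ?B = ?B" by auto
    then show ?thesis
      using translation_invariant_borel_measure_unique[OF sets_slice_measure sigma_finite_slice_measure[OF v]
        slice_measure_translation_invariant[OF v] A, of ?B] by simp
  qed
  obtain b :: "real ^ 'n" where b: "b \<in> Basis" and
    cube: "coord_unit_cube (DIM(real ^ 'n) - 1) = cbox 0 One \<inter> {x. x \<bullet> b = 0}"
    by (rule coord_unit_cube_eq_cbox_slice)
  have nb: "norm b = 1" using b by simp
  have ball: "emeasure (slice_measure u) ?B = emeasure (slice_measure b) ?B"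
    unfolding emeasure_slice_measure(1)[OF u borel_closed[OF closed_cball]]
      emeasure_slice_measure(1)[OF nb borel_closed[OF closed_cball]]
    by (intro nn_integral_cong hausdorff_measure_rotate[OF u nb])
       (auto simp: orthogonal_transformation_norm)
  have "emeasure ?H (cbox 0 One \<inter> {x. x \<bullet> b = s}) = indicator {0..1} s" for s
  proof (cases "s \<in> {0..1}")
    case True
    have "(\<lambda>x. s *\<^sub>R b + x) -` (cbox 0 One \<inter> {x. x \<bullet> b = s}) = coord_unit_cube (DIM(real ^ 'n) - 1)"
    proof -
      have "0 \<le> s * (b \<bullet> i) + x \<bullet> i \<and> s * (b \<bullet> i) + x \<bullet> i \<le> 1 \<longleftrightarrow> 0 \<le> x \<bullet> i \<and> x \<bullet> i \<le> 1"
        if "x \<bullet> b = 0" "i \<in> Basis" for x i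
        using b True that by (cases "i = b") (auto simp: inner_not_same_Basis)
      moreover have "b \<bullet> b = 1" using b by simp
      ultimately show ?thesis
        unfolding cube by (auto simp: mem_box inner_add_left)
    qed
    then have "emeasure ?H (cbox 0 One \<inter> {x. x \<bullet> b = s}) = emeasure ?H (coord_unit_cube (DIM(real ^ 'n) - 1))"
      using hausdorff_measure_translate[of "cbox 0 One \<inter> {x. x \<bullet> b = s}" _ "s *\<^sub>R b"] by simp
    also have "\<dots> = 1"
      using emeasure_hausdorff_measure_coord_unit_cube[where 'a = "real ^ 'n"] by simp
    finally show ?thesis using True by simp
  next
    case False
    then have "cbox 0 One \<inter> {x. x \<bullet> b = s} = {}" using b by (auto simp: mem_box)
    with False show ?thesis by simp
  qed
  then have "emeasure (slice_measure b) (cbox 0 One) = 1"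
    by (simp add: emeasure_slice_measure(1)[OF nb])
  with unique[OF nb, of "cbox 0 One"] have "emeasure (slice_measure b) ?B = emeasure lborel ?B"
    by (simp add: emeasure_lborel_cbox_eq)
  with unique[OF u A] ball have "emeasure lborel ?B * emeasure (slice_measure u) A = emeasure lborel ?B * emeasure lborel A"
    by (simp add: mult.commute)
  moreover have "emeasure lborel ?B \<noteq> 0" "emeasure lborel ?B \<noteq> \<infinity>"
    using content_cball_pos[of 1 "0 :: real ^ 'n"] emeasure_lborel_cball_finite[of "0 :: real ^ 'n" 1]
    by (auto simp: measure_def)
  ultimately have "emeasure (slice_measure u) A = emeasure lborel A"
    by (simp add: ennreal_mult_cancel_left)
  then show ?thesis by (simp add: emeasure_slice_measure(1)[OF u A])
qed

section \<open>An integral bound on an interval\<close>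

text \<open>
This is \<open>ln (p ^ 2) \<le> p ^ 2 - 1\<close> in exponential form.
\<close>

lemma mult_exp_half_one_minus_square_le_1:
  assumes "(p :: real) > 0"
  shows "p * exp ((1 - p\<^sup>2) / 2) \<le> 1"
proof -
  have "2 * ln p = ln (p\<^sup>2)" using assms by (simp add: ln_realpow)
  also have "\<dots> \<le> p\<^sup>2 - 1" using assms by (intro ln_le_minus_one) simp
  finally have "ln p + (1 - p\<^sup>2) / 2 \<le> 0" by (simp add: field_simps)
  then have "exp (ln p + (1 - p\<^sup>2) / 2) \<le> 1" by simp
  then show ?thesis using assms by (simp add: exp_add)
qed

text \<open>
The derivative of \<open>f\<close> is \<open>(1 - B) + (1 - A) / q ^ 2\<close>, where \<open>A\<close> and \<open>B\<close> are the
left-hand side of the preceding bound at \<open>1 / q\<close> and at \<open>q\<close>. Since \<open>f 1 = 0\<close>, monotonicity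
determines the sign of \<open>f\<close> on both sides of 1.
\<close>

lemma exp_difference_mono:
  fixes x y :: real
  defines "f \<equiv> \<lambda>q. q - 1 / q - exp ((1 - (1 / q)\<^sup>2) / 2) + exp ((1 - q\<^sup>2) / 2)"
  assumes "0 < x" "x \<le> y"
  shows "f x \<le> f y"
proof (rule DERIV_nonneg_imp_nondecreasing[OF \<open>x \<le> y\<close>])
  fix q assume "x \<le> q" "q \<le> y"
  with assms have q: "0 < q" by simp
  define A where "A = (1 / q) * exp ((1 - (1 / q)\<^sup>2) / 2)"
  define B where "B = q * exp ((1 - q\<^sup>2) / 2)"
  have "(f has_real_derivative (1 - B) + (1 / q\<^sup>2) * (1 - A)) (at q)"
    unfolding f_def A_def B_def using q
    by (auto intro!: derivative_eq_intros simp: field_simps power2_eq_square)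
  moreover have "A \<le> 1" "B \<le> 1"
    unfolding A_def B_def using q by (intro mult_exp_half_one_minus_square_le_1; simp)+
  ultimately show "\<exists>D. (f has_real_derivative D) (at q) \<and> 0 \<le> D"
    using q by (intro exI[of _ "(1 - B) + (1 / q\<^sup>2) * (1 - A)"]) auto
qed

text \<open>
The slope \<open>l\<close> that minimises the integral is only given by a transcendental equation; the chosen
\<open>l\<close> is explicit and good enough for the geometric mean. With \<open>q = sqrt (\<alpha> / \<beta>)\<close> one has
\<open>2 * l * sqrt (\<alpha> * \<beta>) = q - 1 / q\<close>, \<open>l * \<beta> = (1 - 1 / q ^ 2) / 2\<close> and \<open>l * \<alpha> = (q ^ 2 - 1) / 2\<close>, so
that the bound becomes the sign of the function in the preceding lemma.
\<close>

lemma exp_integral_le_geometric_mean: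
  fixes \<alpha> \<beta> :: real
  assumes "0 < \<alpha>" "0 < \<beta>"
  defines "l \<equiv> (\<alpha> - \<beta>) / (2 * \<alpha> * \<beta>)"
  shows "(\<integral>\<^sup>+y. ennreal (exp (- l * y)) * indicator {-\<beta>..\<alpha>} y \<partial>lborel) \<le> ennreal (2 * sqrt (\<alpha> * \<beta>))"
proof (cases "\<alpha> = \<beta>")
  case True
  then show ?thesis using assms by (simp add: l_def)
next
  case False
  then have l0: "l \<noteq> 0" using assms by (simp add: l_def)
  define q where "q = sqrt (\<alpha> / \<beta>)"
  have q: "0 < q" "q\<^sup>2 = \<alpha> / \<beta>" using assms by (simp_all add: q_def)
  have "(\<integral>\<^sup>+y. ennreal (exp (- l * y)) * indicator {-\<beta>..\<alpha>} y \<partial>lborel)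
      = ennreal (- exp (- l * \<alpha>) / l - - exp (- l * (- \<beta>)) / l)"
    using assms l0 by (intro nn_integral_FTC_Icc) (auto intro!: derivative_eq_intros)
  also have "- exp (- l * \<alpha>) / l - - exp (- l * (- \<beta>)) / l = (exp (l * \<beta>) - exp (- l * \<alpha>)) / l"
    by (simp add: diff_divide_distrib)
  also have "l * \<beta> = (1 - (1 / q)\<^sup>2) / 2"
    using assms by (simp add: power_divide q l_def field_simps)
  also have "- l * \<alpha> = (1 - q\<^sup>2) / 2"
    using assms by (simp add: q l_def field_simps)
  also have "(exp ((1 - (1 / q)\<^sup>2) / 2) - exp ((1 - q\<^sup>2) / 2)) / l \<le> 2 * sqrt (\<alpha> * \<beta>)"
  proof -
    define e where "e = exp ((1 - (1 / q)\<^sup>2) / 2) - exp ((1 - q\<^sup>2) / 2)"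
    have "sqrt (\<alpha> * \<beta>) = \<beta> * q"
      using assms by (simp add: q_def real_sqrt_divide real_sqrt_mult) (simp add: field_simps)
    then have *: "2 * sqrt (\<alpha> * \<beta>) * l = q - 1 / q"
    proof -
      have "\<alpha> = \<beta> * q\<^sup>2" using assms by (simp add: q(2))
      then have "l = (q\<^sup>2 - 1) / (2 * \<beta> * q\<^sup>2)"
        using assms q(1) by (simp add: l_def field_simps power2_eq_square)
      then show ?thesis
        using \<open>sqrt (\<alpha> * \<beta>) = \<beta> * q\<close> assms(2) q(1) by (simp add: field_simps power2_eq_square)
    qed
    show ?thesis
    proof (cases "\<alpha> > \<beta>")
      case True
      then have "0 < l" using assms by (simp add: l_def)
      have "1 \<le> q" using True assms by (simp add: q_def)
      with exp_difference_mono[of 1 q] have "e \<le> 2 * sqrt (\<alpha> * \<beta>) * l"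
        unfolding * by (simp add: e_def)
      then show ?thesis using \<open>0 < l\<close> by (simp add: e_def pos_divide_le_eq)
    next
      case False
      with \<open>\<alpha> \<noteq> \<beta>\<close> have "l < 0" using assms by (simp add: l_def divide_neg_pos)
      have "q \<le> 1" using False assms by (simp add: q_def)
      with exp_difference_mono[of q 1] q(1) have "e \<ge> 2 * sqrt (\<alpha> * \<beta>) * l"
        unfolding * by (simp add: e_def)
      then show ?thesis using \<open>l < 0\<close> by (simp add: e_def neg_divide_le_eq)
    qed
  qed
  finally show ?thesis by (simp add: ennreal_leI)
qed

section \<open>Support functions and centered bodies\<close>

lemma support_fun_eqI:
  assumes "x \<in> B" "\<And>y. y \<in> B \<Longrightarrow> y \<bullet> v \<le> x \<bullet> v"
  shows "support_fun B v = x \<bullet> v"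
  unfolding support_fun_def using assms by (intro cSup_eq_maximum) auto

lemma support_fun_attained:
  assumes "compact B" "B \<noteq> {}"
  obtains x where "x \<in> B" "support_fun B v = x \<bullet> v" "\<And>y. y \<in> B \<Longrightarrow> y \<bullet> v \<le> x \<bullet> v"
proof -
  have "continuous_on B (\<lambda>x. x \<bullet> v)" by (intro continuous_intros)
  from continuous_attains_sup[OF assms this] obtain x where
    "x \<in> B" "\<And>y. y \<in> B \<Longrightarrow> y \<bullet> v \<le> x \<bullet> v" by blast
  with support_fun_eqI[OF this] that show thesis by blast
qed

lemma inner_le_support_fun:
  assumes "compact B" "y \<in> B"
  shows "y \<bullet> v \<le> support_fun B v"
  using support_fun_attained[of B v] assms by (metis empty_iff)

lemma support_fun_scaleR:
  assumes "compact B" "B \<noteq> {}" "0 \<le> c"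
  shows "support_fun B (c *\<^sub>R v) = c * support_fun B v"
proof -
  obtain x where "x \<in> B" "support_fun B v = x \<bullet> v" "\<And>y. y \<in> B \<Longrightarrow> y \<bullet> v \<le> x \<bullet> v"
    by (rule support_fun_attained[OF assms(1,2), of v]) (rule that)
  with support_fun_eqI[of x B "c *\<^sub>R v"] \<open>0 \<le> c\<close> show ?thesis
    by (simp add: mult_left_mono)
qed

lemma continuous_on_support_fun:
  assumes "compact B" "B \<noteq> {}"
  shows "continuous_on S (support_fun B)"
proof -
  obtain r where r: "0 < r" "\<And>x. x \<in> B \<Longrightarrow> norm x \<le> r"
    using compact_imp_bounded[OF assms(1)] by (metis bounded_pos)
  have lip: "support_fun B u - support_fun B v \<le> r * norm (u - v)" for u v
  proof -
    obtain x where x: "x \<in> B" "support_fun B u = x \<bullet> u"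
      by (rule support_fun_attained[OF assms, of u]) (rule that)
    have "support_fun B u - support_fun B v \<le> x \<bullet> (u - v)"
      using inner_le_support_fun[OF assms(1) x(1), of v] x(2) by (simp add: inner_diff_right)
    also have "\<dots> \<le> norm x * norm (u - v)" by (rule norm_cauchy_schwarz)
    also have "\<dots> \<le> r * norm (u - v)" using r(2)[OF x(1)] by (simp add: mult_right_mono)
    finally show ?thesis .
  qed
  have "dist (support_fun B u) (support_fun B v) \<le> r * dist u v" for u v
    using lip[of u v] lip[of v u] by (simp add: dist_norm norm_minus_commute abs_le_iff)
  then have "r-lipschitz_on S (support_fun B)"
    using r(1) by (intro lipschitz_onI) auto
  then show ?thesis by (rule lipschitz_on_continuous_on)
qed

lemma centered_integral_inner:
  fixes K :: "'a::euclidean_space set"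
  assumes "compact K" "0 < measure lebesgue K" "centered K"
  shows "integrable lborel (\<lambda>x. indicator K x * (x \<bullet> v))"
    and "(\<integral>x. indicator K x * (x \<bullet> v) \<partial>lborel) = 0"
proof -
  have int: "integrable lborel (\<lambda>x. indicator K x *\<^sub>R x)"
    using borel_integrable_compact[OF assms(1), of "\<lambda>x. x"] by (simp add: indicator_scaleR_eq_if)
  have "(\<integral>x. indicator K x *\<^sub>R x \<partial>lborel) = (\<integral>x. indicator K x *\<^sub>R x \<partial>lebesgue)"
    using int by (intro integral_completion[symmetric]) (rule borel_measurable_integrable)
  also have "\<dots> = 0"
    using assms(2,3) by (auto simp: centered_def barycenter_def set_lebesgue_integral_def)
  finally have zero: "(\<integral>x. indicator K x *\<^sub>R x \<partial>lborel) = 0" .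
  show "integrable lborel (\<lambda>x. indicator K x * (x \<bullet> v))"
    using integrable_inner_left[OF int, of v] by simp
  show "(\<integral>x. indicator K x * (x \<bullet> v) \<partial>lborel) = 0"
    using integral_inner_left[of v lborel "\<lambda>x. indicator K x *\<^sub>R x"] int zero by simp
qed

text \<open>
If the support function were nonpositive at \<open>v\<close>, the integrand \<open>x \<bullet> v\<close> would be nonpositive on \<open>K\<close>
with integral 0, and \<open>K\<close> would lie in a hyperplane up to a null set.
\<close>

lemma centered_support_fun_pos:
  fixes K :: "'a::euclidean_space set"
  assumes "compact K" "0 < measure lebesgue K" "centered K" "v \<noteq> 0"
  shows "0 < support_fun K v"
proof (rule ccontr)
  assume "\<not> ?thesis"
  then have neg: "x \<bullet> v \<le> 0" if "x \<in> K" for x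
    using inner_le_support_fun[OF assms(1) that, of v] by linarith
  note I = centered_integral_inner[OF assms(1-3), of v]
  have "AE x in lborel. - (indicator K x * (x \<bullet> v)) = 0"
    using I neg by (subst integral_nonneg_eq_0_iff_AE[symmetric]) (auto simp: indicator_def)
  then have "AE x in lborel. x \<notin> K \<or> x \<bullet> v = 0"
    by eventually_elim (auto simp: indicator_def split: if_splits)
  moreover have "AE x in lborel. x \<bullet> v \<noteq> 0"
  proof -
    have "negligible {x. v \<bullet> x = 0}" using \<open>v \<noteq> 0\<close> by (rule negligible_hyperplane[OF disjI1])
    then have "{x. x \<bullet> v = 0} \<in> null_sets lborel"
      by (simp add: negligible_iff_null_sets null_sets_completion_iff inner_commute)
    then show ?thesis by (rule AE_I'[where N = "{x. x \<bullet> v = 0}"]) auto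
  qed
  ultimately have "AE x in lborel. x \<notin> K" by eventually_elim auto
  moreover have K: "K \<in> sets borel" using assms(1) by (rule borel_compact)
  ultimately have "emeasure lborel K = 0"
    by (subst AE_iff_measurable[symmetric]) auto
  then show False using assms(2) K by (simp add: measure_def)
qed

text \<open>
Integrate \<open>1 - x \<bullet> v \<le> exp (- (x \<bullet> v))\<close> over \<open>K\<close>; the linear term vanishes because \<open>K\<close> is centered.
\<close>

lemma centered_volume_le_exp_integral:
  fixes K :: "'a::euclidean_space set"
  assumes "compact K" "0 < measure lebesgue K" "centered K"
  shows "ennreal (measure lebesgue K) \<le> (\<integral>\<^sup>+x. ennreal (exp (- (x \<bullet> v))) * indicator K x \<partial>lborel)"
proof -
  note I = centered_integral_inner[OF assms, of v]
  have K: "K \<in> sets borel" using assms(1) by (rule borel_compact)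
  have one: "integrable lborel (\<lambda>x. indicator K x :: real)"
    using borel_integrable_compact[OF assms(1), of "\<lambda>x. 1 :: real"] by (simp add: indicator_def if_distrib)
  have ex: "integrable lborel (\<lambda>x. indicator K x * exp (- (x \<bullet> v)))"
    using borel_integrable_compact[OF assms(1), of "\<lambda>x. exp (- (x \<bullet> v))"]
    by (simp add: indicator_scaleR_eq_if[where 'a = real, simplified] continuous_intros)
  have "measure lebesgue K = (\<integral>x. indicator K x \<partial>lborel)" using K by simp
  also have "\<dots> = (\<integral>x. indicator K x - indicator K x * (x \<bullet> v) \<partial>lborel)"
    using I one by (subst Bochner_Integration.integral_diff) auto
  also have "\<dots> \<le> (\<integral>x. indicator K x * exp (- (x \<bullet> v)) \<partial>lborel)"
  proof (rule integral_mono)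
    show "indicator K x - indicator K x * (x \<bullet> v) \<le> indicator K x * exp (- (x \<bullet> v))" for x
      using exp_ge_add_one_self[of "- (x \<bullet> v)"] by (simp add: indicator_def)
  qed (use I one ex in auto)
  finally have "ennreal (measure lebesgue K) \<le> ennreal (\<integral>x. indicator K x * exp (- (x \<bullet> v)) \<partial>lborel)"
    by (rule ennreal_leI)
  also have "\<dots> = (\<integral>\<^sup>+x. ennreal (indicator K x * exp (- (x \<bullet> v))) \<partial>lborel)"
    using ex by (intro nn_integral_eq_integral[symmetric]) auto
  also have "\<dots> = (\<integral>\<^sup>+x. ennreal (exp (- (x \<bullet> v))) * indicator K x \<partial>lborel)"
    by (intro nn_integral_cong) (auto simp: indicator_def)
  finally show ?thesis .
qed

section \<open>Parallelotopes in dual coordinates\<close>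

text \<open>
A basis \<open>d\<close> and its dual basis \<open>g\<close>, both indexed by the standard basis: \<open>x \<bullet> g b\<close> is the coordinate
of \<open>x\<close> along \<open>d b\<close>. The centrally symmetric parallelotope with edge vectors \<open>2 * d b\<close> is the set of
points whose coordinates lie between \<open>- 1\<close> and 1, and its facets have normals in the directions
\<open>g b\<close> and \<open>- g b\<close>.
\<close>

locale dual_bases =
  fixes d g :: "'a::euclidean_space \<Rightarrow> 'a"
  assumes dual: "\<And>b c. \<lbrakk>b \<in> Basis; c \<in> Basis\<rbrakk> \<Longrightarrow> d b \<bullet> g c = (if b = c then 1 else 0)"
    and expansion: "\<And>x. x = (\<Sum>b\<in>Basis. (x \<bullet> g b) *\<^sub>R d b)"
begin

definition box_of :: "('a \<Rightarrow> real) \<Rightarrow> ('a \<Rightarrow> real) \<Rightarrow> 'a set" where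
  "box_of l h = {x. \<forall>b\<in>Basis. l b \<le> x \<bullet> g b \<and> x \<bullet> g b \<le> h b}"

abbreviation paral :: "'a set" where
  "paral \<equiv> box_of (\<lambda>_. - 1) (\<lambda>_. 1)"

text \<open>
A facet is addressed by a pair: the basis vector whose coordinate is extremal there, and the sign
of that coordinate.
\<close>

definition facet_interior :: "'a \<times> real \<Rightarrow> 'a set" where
  "facet_interior p = {x. x \<bullet> g (fst p) = snd p \<and> (\<forall>c\<in>Basis - {fst p}. \<bar>x \<bullet> g c\<bar> < 1)}"

definition facet_normal :: "'a \<times> real \<Rightarrow> 'a" where
  "facet_normal p = (snd p / norm (g (fst p))) *\<^sub>R g (fst p)"

lemma g_nonzero: "b \<in> Basis \<Longrightarrow> g b \<noteq> 0"
  using dual[of b b] by auto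

lemma paral_iff: "x \<in> paral \<longleftrightarrow> (\<forall>b\<in>Basis. \<bar>x \<bullet> g b\<bar> \<le> 1)"
  by (auto simp: box_of_def abs_le_iff minus_le_iff)

lemma inner_expansion: "y \<bullet> v = (\<Sum>b\<in>Basis. (y \<bullet> g b) * (d b \<bullet> v))"
  by (subst expansion[of y]) (simp add: inner_sum_left)

lemma expansion': "v = (\<Sum>b\<in>Basis. (d b \<bullet> v) *\<^sub>R g b)"
proof (rule vector_eq_ldot[THEN iffD1], rule allI)
  fix y show "y \<bullet> v = y \<bullet> (\<Sum>b\<in>Basis. (d b \<bullet> v) *\<^sub>R g b)"
    by (subst inner_expansion) (simp add: inner_sum_right mult.commute)
qed

lemma coord_add: "b \<in> Basis \<Longrightarrow> c \<in> Basis \<Longrightarrow> (x + t *\<^sub>R d c) \<bullet> g b = x \<bullet> g b + (if b = c then t else 0)"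
  using dual by (simp add: inner_add_left)

lemma compact_box_of: "compact (box_of l h)"
proof -
  have "closed (\<Inter>b\<in>Basis. {x. l b \<le> x \<bullet> g b} \<inter> {x. x \<bullet> g b \<le> h b})"
    by (intro closed_INT ballI closed_Int closed_Collect_le continuous_intros)
  also have "(\<Inter>b\<in>Basis. {x. l b \<le> x \<bullet> g b} \<inter> {x. x \<bullet> g b \<le> h b}) = box_of l h"
    by (auto simp: box_of_def)
  finally have "closed (box_of l h)" .
  moreover have "norm x \<le> (\<Sum>b\<in>Basis. (\<bar>l b\<bar> + \<bar>h b\<bar>) * norm (d b))" if "x \<in> box_of l h" for x
  proof -
    have "norm x \<le> (\<Sum>b\<in>Basis. norm ((x \<bullet> g b) *\<^sub>R d b))"
      by (subst expansion[of x]) (rule norm_sum)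
    also have "\<dots> \<le> (\<Sum>b\<in>Basis. (\<bar>l b\<bar> + \<bar>h b\<bar>) * norm (d b))"
      using that by (intro sum_mono) (fastforce simp: box_of_def intro: mult_right_mono)
    finally show ?thesis .
  qed
  then have "bounded (box_of l h)" by (auto simp: bounded_iff)
  ultimately show ?thesis by (simp add: compact_eq_bounded_closed)
qed

lemma emeasure_paral: "emeasure lborel paral = ennreal (measure lebesgue paral)"
proof -
  have "paral \<in> sets lborel" using borel_compact[OF compact_box_of] by simp
  moreover have "emeasure lborel paral < \<infinity>"
    by (rule emeasure_bounded_finite[OF compact_imp_bounded[OF compact_box_of]])
  ultimately show ?thesis by (simp add: emeasure_eq_ennreal_measure)
qed

lemma convex_box_of: "convex (box_of l h)"
proof -
  have "convex (\<Inter>b\<in>Basis. {x. g b \<bullet> x \<ge> l b} \<inter> {x. g b \<bullet> x \<le> h b})"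
    by (intro convex_INT convex_Int convex_halfspace_ge convex_halfspace_le)
  also have "(\<Inter>b\<in>Basis. {x. g b \<bullet> x \<ge> l b} \<inter> {x. g b \<bullet> x \<le> h b}) = box_of l h"
    by (auto simp: box_of_def inner_commute)
  finally show ?thesis .
qed

lemma open_paral_interior: "open {x. \<forall>b\<in>Basis. \<bar>x \<bullet> g b\<bar> < 1}"
proof -
  have "open (\<Inter>b\<in>Basis. {x. \<bar>x \<bullet> g b\<bar> < 1})"
    by (intro open_INT ballI open_Collect_less continuous_intros finite_Basis)
  also have "(\<Inter>b\<in>Basis. {x. \<bar>x \<bullet> g b\<bar> < 1}) = {x. \<forall>b\<in>Basis. \<bar>x \<bullet> g b\<bar> < 1}" by auto
  finally show ?thesis .
qed

lemma interior_paral: "interior paral = {x. \<forall>b\<in>Basis. \<bar>x \<bullet> g b\<bar> < 1}"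
proof
  show "{x. \<forall>b\<in>Basis. \<bar>x \<bullet> g b\<bar> < 1} \<subseteq> interior paral"
  proof (rule interior_maximal[OF subsetI open_paral_interior])
    fix x assume "x \<in> {x. \<forall>b\<in>Basis. \<bar>x \<bullet> g b\<bar> < 1}"
    then have "\<bar>x \<bullet> g b\<bar> \<le> 1" if "b \<in> Basis" for b
      using that by (intro less_imp_le) blast
    then show "x \<in> paral" unfolding paral_iff by blast
  qed
  show "interior paral \<subseteq> {x. \<forall>b\<in>Basis. \<bar>x \<bullet> g b\<bar> < 1}"
  proof (rule subsetI, rule CollectI, rule ballI, rule ccontr)
    fix x b assume x: "x \<in> interior paral" and b: "b \<in> (Basis :: 'a set)" and "\<not> \<bar>x \<bullet> g b\<bar> < 1"
    obtain e where e: "0 < e" "ball x e \<subseteq> paral" using x by (auto simp: mem_interior)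
    have db: "0 < norm (d b)" using dual[OF b b] by auto
    define t where "t = (if 0 \<le> x \<bullet> g b then 1 else -1) * (e / (2 * norm (d b)))"
    have "x + t *\<^sub>R d b \<in> ball x e"
      using e(1) db by (simp add: dist_norm t_def)
    then have "\<bar>(x + t *\<^sub>R d b) \<bullet> g b\<bar> \<le> 1" using e(2) b by (auto simp: paral_iff)
    then have "\<bar>x \<bullet> g b + t\<bar> \<le> 1" using coord_add[OF b b] by simp
    moreover have "0 < e / (2 * norm (d b))" using e(1) db by simp
    ultimately show False using \<open>\<not> \<bar>x \<bullet> g b\<bar> < 1\<close>
      unfolding t_def by (auto split: if_splits)
  qed
qed

lemma frontier_paral: "frontier paral = {x \<in> paral. \<exists>b\<in>Basis. \<bar>x \<bullet> g b\<bar> = 1}"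
proof -
  have "frontier paral = paral - interior paral"
    using compact_imp_closed[OF compact_box_of] by (simp add: frontier_def closure_closed)
  also have "\<dots> = {x \<in> paral. \<exists>b\<in>Basis. \<bar>x \<bullet> g b\<bar> = 1}"
    unfolding interior_paral by (auto simp: paral_iff) (metis less_le)
  finally show ?thesis .
qed

definition facets :: "('a \<times> real) set" where
  "facets = Basis \<times> {1, -1}"

lemma finite_facets: "finite facets" by (simp add: facets_def)

lemma norm_facet_normal: "p \<in> facets \<Longrightarrow> norm (facet_normal p) = 1"
  using g_nonzero by (auto simp: facets_def facet_normal_def)

lemma inner_facet_normal:
  "p \<in> facets \<Longrightarrow> x \<bullet> facet_normal p = snd p * (x \<bullet> g (fst p)) / norm (g (fst p))"
  by (simp add: facet_normal_def)

lemma outer_normal_facet: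
  assumes p: "p \<in> facets" and x: "x \<in> paral" "x \<bullet> g (fst p) = snd p"
  shows "outer_unit_normal_at paral x (facet_normal p)"
  unfolding outer_unit_normal_at_def
proof (intro conjI ballI norm_facet_normal[OF p])
  fix y assume "y \<in> paral"
  then have "\<bar>y \<bullet> g (fst p)\<bar> \<le> 1" using p by (auto simp: paral_iff facets_def)
  moreover have "snd p * snd p = 1" "\<bar>snd p\<bar> = 1" using p by (auto simp: facets_def)
  ultimately have "snd p * (y \<bullet> g (fst p)) \<le> snd p * (x \<bullet> g (fst p))"
    unfolding x(2) by (metis abs_ge_self abs_mult mult_1 order_trans)
  then show "y \<bullet> facet_normal p \<le> x \<bullet> facet_normal p"
    unfolding inner_facet_normal[OF p] by (rule divide_right_mono) simp
qed

lemma facet_interior_subset: "p \<in> facets \<Longrightarrow> x \<in> facet_interior p \<Longrightarrow> x \<in> paral"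
  by (auto simp: facet_interior_def paral_iff facets_def) (metis DiffI abs_1 abs_minus less_imp_le order_refl singletonD)+

text \<open>
From a point in the relative interior of a facet one can move in both directions along \<open>d c\<close>, for
each \<open>c\<close> other than the index of the facet, without leaving the parallelotope. A normal vector is
therefore orthogonal to all these \<open>d c\<close>, that is, a multiple of a single \<open>g b\<close>. Moving inwards
along \<open>d b\<close> fixes the sign.
\<close>

lemma outer_normal_facet_unique:
  assumes p: "p \<in> facets" and x: "x \<in> facet_interior p" and v: "outer_unit_normal_at paral x v"
  shows "v = facet_normal p"
proof -
  obtain b s where ps: "p = (b, s)" "b \<in> Basis" "s = 1 \<or> s = -1" using p by (auto simp: facets_def)
  have xb: "x \<bullet> g b = s" and xc: "\<And>c. c \<in> Basis \<Longrightarrow> c \<noteq> b \<Longrightarrow> \<bar>x \<bullet> g c\<bar> < 1"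
    using x by (auto simp: facet_interior_def ps)
  have nv: "norm v = 1" and le: "\<And>y. y \<in> paral \<Longrightarrow> y \<bullet> v \<le> x \<bullet> v"
    using v by (auto simp: outer_unit_normal_at_def)
  have step: "t * (d c \<bullet> v) \<le> 0" if "x + t *\<^sub>R d c \<in> paral" for t c
    using le[OF that] by (simp add: inner_add_left)
  have zero: "d c \<bullet> v = 0" if c: "c \<in> Basis" "c \<noteq> b" for c
  proof -
    define t where "t = 1 - \<bar>x \<bullet> g c\<bar>"
    have t: "0 < t" using xc[OF c] by (simp add: t_def)
    have mem: "x + t' *\<^sub>R d c \<in> paral" if "\<bar>t'\<bar> = t" for t'
      unfolding paral_iff
    proof
      fix a :: 'a assume a: "a \<in> Basis"
      show "\<bar>(x + t' *\<^sub>R d c) \<bullet> g a\<bar> \<le> 1"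
        unfolding coord_add[OF a c(1)]
        using xc[OF a] xb ps that by (cases "a = c"; cases "a = b") (auto simp: t_def)
    qed
    have "t * (d c \<bullet> v) \<le> 0" by (rule step[OF mem]) (use t in simp)
    moreover have "- t * (d c \<bullet> v) \<le> 0" by (rule step[OF mem]) (use t in simp)
    ultimately show ?thesis using t by (simp add: mult_le_0_iff zero_le_mult_iff)
  qed
  have "x + (- s) *\<^sub>R d b \<in> paral"
    unfolding paral_iff
  proof
    fix a :: 'a assume a: "a \<in> Basis"
    show "\<bar>(x + (- s) *\<^sub>R d b) \<bullet> g a\<bar> \<le> 1"
      unfolding coord_add[OF a ps(2)] using xc[OF a] xb by auto
  qed
  from step[OF this] have pos: "0 \<le> s * (d b \<bullet> v)" by simp
  have v_eq: "v = (d b \<bullet> v) *\<^sub>R g b"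
  proof -
    have "v = (\<Sum>c\<in>Basis. (d c \<bullet> v) *\<^sub>R g c)" by (rule expansion')
    also have "\<dots> = (d b \<bullet> v) *\<^sub>R g b"
      using zero ps(2) by (subst sum.remove[of _ b]) auto
    finally show ?thesis .
  qed
  then have "\<bar>d b \<bullet> v\<bar> * norm (g b) = 1" using nv by (metis norm_scaleR)
  then have "d b \<bullet> v = s / norm (g b)"
    using pos ps(3) g_nonzero[OF ps(2)] by (auto simp: field_simps zero_le_mult_iff)
  with v_eq show ?thesis by (simp add: facet_normal_def ps)
qed

lemma gauss_map_facet:
  assumes "p \<in> facets" "x \<in> facet_interior p"
  shows "gauss_map paral x = facet_normal p"
  unfolding gauss_map_def
proof (rule the_equality)
  show "outer_unit_normal_at paral x (facet_normal p)"
    using assms by (intro outer_normal_facet facet_interior_subset) (auto simp: facet_interior_def)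
qed (rule outer_normal_facet_unique[OF assms])

text \<open>
A boundary point with two extremal coordinates has two different outer normals, so the regular
points are exactly the relative interiors of the facets. No exceptional null set has to be
handled afterwards.
\<close>

lemma regular_boundary_paral: "regular_boundary paral = (\<Union>p\<in>facets. facet_interior p)"
proof (intro equalityI subsetI)
  fix x assume "x \<in> (\<Union>p\<in>facets. facet_interior p)"
  then obtain p where p: "p \<in> facets" "x \<in> facet_interior p" by blast
  then have x: "x \<in> paral" "x \<bullet> g (fst p) = snd p"
    using facet_interior_subset by (auto simp: facet_interior_def)
  with p have "x \<in> frontier paral" by (auto simp: frontier_paral facets_def intro!: bexI[of _ "fst p"])
  moreover have "\<exists>!u. outer_unit_normal_at paral x u"
    using outer_normal_facet[OF p(1) x] outer_normal_facet_unique[OF p] by blast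
  ultimately show "x \<in> regular_boundary paral" by (simp add: regular_boundary_def)
next
  fix x assume "x \<in> regular_boundary paral"
  then have fr: "x \<in> frontier paral" and ex1: "\<exists>!u. outer_unit_normal_at paral x u"
    by (auto simp: regular_boundary_def)
  from fr obtain b where b: "b \<in> Basis" "\<bar>x \<bullet> g b\<bar> = 1" and x: "x \<in> paral"
    by (auto simp: frontier_paral)
  define p where "p c = (c, x \<bullet> g c)" for c
  have p: "p c \<in> facets" if "c \<in> Basis" "\<bar>x \<bullet> g c\<bar> = 1" for c
    using that by (auto simp: p_def facets_def abs_if split: if_splits)
  have "\<bar>x \<bullet> g c\<bar> < 1" if c: "c \<in> Basis" "c \<noteq> b" for c
  proof (rule ccontr)
    assume "\<not> \<bar>x \<bullet> g c\<bar> < 1"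
    then have c1: "\<bar>x \<bullet> g c\<bar> = 1" using x c by (auto simp: paral_iff intro: antisym)
    have "facet_normal (p b) = facet_normal (p c)"
      using ex1 outer_normal_facet[OF p[OF b] x] outer_normal_facet[OF p[OF c(1) c1] x]
      by (auto simp: p_def)
    then have "d b \<bullet> facet_normal (p b) = d b \<bullet> facet_normal (p c)" by simp
    then show False
      using b c dual[OF b(1) b(1)] dual[OF b(1) c(1)] g_nonzero[OF b(1)]
      by (simp add: facet_normal_def p_def)
  qed
  then have "x \<in> facet_interior (p b)" by (simp add: facet_interior_def p_def)
  with p[OF b] show "x \<in> (\<Union>p\<in>facets. facet_interior p)" by blast
qed

lemma disjoint_facet_interior: "disjoint_family_on facet_interior facets"
proof (unfold disjoint_family_on_def, intro ballI impI)
  fix p q assume pq: "p \<in> facets" "q \<in> facets" "p \<noteq> q"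
  show "facet_interior p \<inter> facet_interior q = {}"
  proof (cases "fst p = fst q")
    case True
    with \<open>p \<noteq> q\<close> have "snd p \<noteq> snd q" by (simp add: prod_eq_iff)
    with True show ?thesis by (auto simp: facet_interior_def)
  next
    case False
    have "x \<notin> facet_interior q" if "x \<in> facet_interior p" for x
    proof
      assume "x \<in> facet_interior q"
      then have "\<bar>x \<bullet> g (fst q)\<bar> = 1" using pq(2) by (auto simp: facet_interior_def facets_def)
      moreover have "\<bar>x \<bullet> g (fst q)\<bar> < 1"
        using that pq(2) False by (auto simp: facet_interior_def facets_def)
      ultimately show False by simp
    qed
    then show ?thesis by blast
  qed
qed

lemma facet_interior_borel: "facet_interior p \<in> sets borel"
proof -
  have "facet_interior p = {x. x \<bullet> g (fst p) = snd p} \<inter> (\<Inter>c\<in>Basis - {fst p}. {x. \<bar>x \<bullet> g c\<bar> < 1})"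
    by (auto simp: facet_interior_def)
  moreover have "{x. x \<bullet> g (fst p) = snd p} \<in> sets borel" by measurable
  moreover have "(\<Inter>c\<in>Basis - {fst p}. {x. \<bar>x \<bullet> g c\<bar> < 1}) \<in> sets borel"
    by (intro borel_open open_INT ballI open_Collect_less continuous_intros finite_Diff finite_Basis)
  ultimately show ?thesis by auto
qed

lemma support_fun_paral:
  assumes p: "p \<in> facets"
  shows "support_fun paral (facet_normal p) = 1 / norm (g (fst p))"
    and "x \<in> facet_interior p \<Longrightarrow> x \<bullet> facet_normal p = 1 / norm (g (fst p))"
proof -
  have s: "snd p * snd p = 1" "\<bar>snd p\<bar> = 1" "fst p \<in> Basis" using p by (auto simp: facets_def)
  show "x \<bullet> facet_normal p = 1 / norm (g (fst p))" if "x \<in> facet_interior p" for x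
    using that s by (simp add: inner_facet_normal[OF p] facet_interior_def)
  define x where "x = 0 + snd p *\<^sub>R d (fst p)"
  have coord: "x \<bullet> g c = (if c = fst p then snd p else 0)" if "c \<in> Basis" for c
    unfolding x_def using s that by (subst coord_add) auto
  then have x: "x \<in> paral" using s by (auto simp: paral_iff)
  have "outer_unit_normal_at paral x (facet_normal p)"
    using outer_normal_facet[OF p x] coord s by simp
  then have "support_fun paral (facet_normal p) = x \<bullet> facet_normal p"
    using x by (intro support_fun_eqI) (auto simp: outer_unit_normal_at_def)
  then show "support_fun paral (facet_normal p) = 1 / norm (g (fst p))"
    using coord s by (simp add: inner_facet_normal[OF p])
qed

end

section \<open>The cone-volume measure of a parallelotope\<close>

locale dual_bases_vec = dual_bases d g for d g :: "real ^ 'n \<Rightarrow> real ^ 'n"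
begin

text \<open>
Slice the parallelotope parallel to the facet. Up to a part of its frontier, which is a null set,
all slices at height between \<open>- a\<close> and \<open>a\<close> are translates of the relative interior of the facet,
where \<open>a = 1 / norm (g b)\<close> is the distance of the facet from the origin. Hence the volume is \<open>2 * a\<close>
times the area of the facet.
\<close>

lemma emeasure_facet_interior:
  assumes p: "p \<in> facets"
  shows "emeasure (hausdorff_measure (CARD('n) - 1)) (facet_interior p)
    = ennreal (measure lebesgue paral * norm (g (fst p)) / 2)"
proof -
  let ?H = "hausdorff_measure (CARD('n) - 1) :: (real ^ 'n) measure"
  obtain b s where ps: "p = (b, s)" "b \<in> Basis" "s = 1 \<or> s = -1" using p by (auto simp: facets_def)
  define a where "a = 1 / norm (g b)"
  have a: "0 < a" using g_nonzero[OF ps(2)] by (simp add: a_def)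
  define w where "w = a *\<^sub>R g b"
  have w: "norm w = 1" using g_nonzero[OF ps(2)] by (simp add: w_def a_def)
  \<comment> \<open>The part of the frontier that is dropped is chosen so that the slices are translates of the
      relative interior of the facet itself.\<close>
  define S where "S = {x. \<bar>x \<bullet> g b\<bar> \<le> 1 \<and> (\<forall>c\<in>Basis - {b}. \<bar>x \<bullet> g c\<bar> < 1)}"
  have S_borel: "S \<in> sets borel"
  proof -
    have "S = {x. \<bar>x \<bullet> g b\<bar> \<le> 1} \<inter> (\<Inter>c\<in>Basis - {b}. {x. \<bar>x \<bullet> g c\<bar> < 1})"
      by (auto simp: S_def)
    moreover have "{x. \<bar>x \<bullet> g b\<bar> \<le> 1} \<in> sets borel" by measurable
    moreover have "(\<Inter>c\<in>Basis - {b}. {x. \<bar>x \<bullet> g c\<bar> < 1}) \<in> sets borel"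
      by (intro borel_open open_INT ballI open_Collect_less continuous_intros finite_Diff finite_Basis)
    ultimately show ?thesis by auto
  qed
  have "S \<union> frontier paral = paral"
  proof
    show "S \<union> frontier paral \<subseteq> paral"
      unfolding frontier_paral by (auto simp: S_def paral_iff) (metis DiffI less_imp_le singletonD)
    show "paral \<subseteq> S \<union> frontier paral"
    proof
      fix x assume x: "x \<in> paral"
      show "x \<in> S \<union> frontier paral"
      proof (cases "\<exists>c\<in>Basis. \<bar>x \<bullet> g c\<bar> = 1")
        case False
        have "\<bar>x \<bullet> g c\<bar> < 1" if "c \<in> Basis" for c
          using x False that unfolding paral_iff by (simp add: less_le)
        then show ?thesis using x ps(2) by (simp add: S_def paral_iff)
      qed (use x in \<open>simp add: frontier_paral\<close>)
    qed
  qed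
  moreover have "frontier paral \<in> null_sets lborel"
    using negligible_convex_frontier[OF convex_box_of, of "\<lambda>_. - 1" "\<lambda>_. 1"]
    by (simp add: negligible_iff_null_sets null_sets_completion_iff borel_closed)
  ultimately have "emeasure lborel paral = emeasure lborel S"
    using emeasure_Un_null_set[of S lborel "frontier paral"] S_borel by simp
  also have "\<dots> = (\<integral>\<^sup>+t. emeasure ?H (S \<inter> {x. x \<bullet> w = t}) \<partial>lborel)"
    by (rule lborel_slices[OF w S_borel])
  also have "\<dots> = (\<integral>\<^sup>+t. emeasure ?H (facet_interior p) * indicator {-a..a} t \<partial>lborel)"
  proof (rule nn_integral_cong)
    fix t
    show "emeasure ?H (S \<inter> {x. x \<bullet> w = t}) = emeasure ?H (facet_interior p) * indicator {-a..a} t"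
    proof (cases "\<bar>t\<bar> \<le> a")
      case True
      define r where "r = t / a"
      have r: "\<bar>r\<bar> \<le> 1" using True a by (simp add: r_def)
      have wt: "x \<bullet> w = t \<longleftrightarrow> x \<bullet> g b = r" for x using a by (simp add: w_def r_def field_simps)
      define z where "z = (r - s) *\<^sub>R d b"
      have zc: "(z + x) \<bullet> g c = x \<bullet> g c + (if c = b then r - s else 0)" if "c \<in> Basis" for x c
        using coord_add[OF that ps(2), of x "r - s"] by (simp add: z_def add.commute)
      have "(\<lambda>x. z + x) -` (S \<inter> {x. x \<bullet> w = t}) = facet_interior p"
        using r ps by (auto simp: S_def facet_interior_def wt zc)
      moreover have "emeasure ?H ((\<lambda>x. z + x) -` (S \<inter> {x. x \<bullet> w = t})) = emeasure ?H (S \<inter> {x. x \<bullet> w = t})"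
        using S_borel by (intro hausdorff_measure_translate) simp
      ultimately show ?thesis using True by (simp add: indicator_def abs_le_iff minus_le_iff)
    next
      case False
      have "S \<inter> {x. x \<bullet> w = t} = {}"
      proof -
        have "\<bar>x \<bullet> w\<bar> \<le> a" if "x \<in> S" for x
          using that a by (simp add: S_def w_def abs_mult)
        with False show ?thesis by auto
      qed
      with False show ?thesis by (auto simp: indicator_def)
    qed
  qed
  also have "\<dots> = emeasure ?H (facet_interior p) * ennreal (2 * a)"
    using a by (simp add: nn_integral_cmult)
  finally have "emeasure ?H (facet_interior p) * ennreal (2 * a) = ennreal (measure lebesgue paral)"
    by (simp add: emeasure_paral)
  then have "emeasure ?H (facet_interior p) = ennreal (measure lebesgue paral) / ennreal (2 * a)"
    using a by (subst ennreal_mult_divide_eq[symmetric, where b = "ennreal (2 * a)"]) auto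
  also have "\<dots> = ennreal (measure lebesgue paral / (2 * a))"
    using a by (intro divide_ennreal) auto
  finally show ?thesis by (simp add: a_def ps)
qed

lemma facet_cases:
  assumes "x \<in> regular_boundary paral"
  obtains p where "p \<in> facets" "x \<in> facet_interior p"
  using assms unfolding regular_boundary_paral by blast

lemma measurable_on_facets:
  assumes h: "\<And>p x. \<lbrakk>p \<in> facets; x \<in> facet_interior p\<rbrakk> \<Longrightarrow> h x = c p"
    and c: "\<And>p. p \<in> facets \<Longrightarrow> c p \<in> space N"
  shows "h \<in> restrict_space (hausdorff_measure k) (regular_boundary paral) \<rightarrow>\<^sub>M N"
proof (rule measurableI)
  have R: "regular_boundary paral \<in> sets borel"
    unfolding regular_boundary_paral using facet_interior_borel finite_facets by blast
  fix A assume "A \<in> sets N"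
  have "h -` A \<inter> regular_boundary paral = (\<Union>p\<in>{p \<in> facets. c p \<in> A}. facet_interior p)"
    unfolding regular_boundary_paral using h by fastforce
  moreover have "(\<Union>p\<in>{p \<in> facets. c p \<in> A}. facet_interior p) \<in> sets borel"
    using facet_interior_borel finite_facets by (intro sets.finite_UN) auto
  moreover have "(\<Union>p\<in>{p \<in> facets. c p \<in> A}. facet_interior p) \<subseteq> regular_boundary paral"
    unfolding regular_boundary_paral by blast
  ultimately show "h -` A \<inter> space (restrict_space (hausdorff_measure k) (regular_boundary paral))
      \<in> sets (restrict_space (hausdorff_measure k) (regular_boundary paral))"
    using R by (simp add: space_restrict_space sets_restrict_space_iff)
next
  fix x assume "x \<in> space (restrict_space (hausdorff_measure k) (regular_boundary paral))"
  then have "x \<in> regular_boundary paral" by (simp add: space_restrict_space)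
  then obtain p where "p \<in> facets" "x \<in> facet_interior p" by (rule facet_cases)
  with h c show "h x \<in> space N" by simp
qed

lemma integral_on_facets:
  fixes h :: "real ^ 'n \<Rightarrow> real"
  assumes h: "\<And>p x. \<lbrakk>p \<in> facets; x \<in> facet_interior p\<rbrakk> \<Longrightarrow> h x = c p"
  shows "(\<integral>x. h x \<partial>restrict_space (hausdorff_measure (CARD('n) - 1)) (regular_boundary paral))
    = (\<Sum>p\<in>facets. measure lebesgue paral * norm (g (fst p)) / 2 * c p)"
proof -
  let ?H = "hausdorff_measure (CARD('n) - 1) :: (real ^ 'n) measure"
  have R: "regular_boundary paral \<in> sets borel"
    unfolding regular_boundary_paral using facet_interior_borel finite_facets by blast
  have "(\<integral>x. h x \<partial>restrict_space ?H (regular_boundary paral)) = (\<integral>x. indicator (regular_boundary paral) x *\<^sub>R h x \<partial>?H)"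
    using R by (intro integral_restrict_space) simp
  also have "\<dots> = (\<integral>x. (\<Sum>p\<in>facets. indicator (facet_interior p) x * c p) \<partial>?H)"
  proof (rule Bochner_Integration.integral_cong[OF refl])
    fix x
    have "indicator (regular_boundary paral) x *\<^sub>R h x = (\<Sum>p\<in>facets. indicator (facet_interior p) x) * h x"
      unfolding regular_boundary_paral
      by (subst indicator_UN_disjoint[OF finite_facets disjoint_facet_interior]) simp
    also have "\<dots> = (\<Sum>p\<in>facets. indicator (facet_interior p) x * c p)"
      unfolding sum_distrib_right using h by (intro sum.cong) (auto simp: indicator_def)
    finally show "indicator (regular_boundary paral) x *\<^sub>R h x = (\<Sum>p\<in>facets. indicator (facet_interior p) x * c p)" .
  qed
  also have "\<dots> = (\<Sum>p\<in>facets. (\<integral>x. indicator (facet_interior p) x * c p \<partial>?H))"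
    by (intro Bochner_Integration.integral_sum integrable_mult_left integrable_real_indicator)
       (auto simp: facet_interior_borel emeasure_facet_interior simp del: One_nat_def)
  also have "\<dots> = (\<Sum>p\<in>facets. measure lebesgue paral * norm (g (fst p)) / 2 * c p)"
    by (intro sum.cong) (auto simp: facet_interior_borel measure_def emeasure_facet_interior simp del: One_nat_def)
  finally show ?thesis .
qed

text \<open>
The density of the cone-volume measure is constant on each facet, with value the height of the
facet divided by the dimension. Height times area is half the volume for every facet, so all
facet normals get the same mass.
\<close>

theorem integral_cone_volume_measure:
  assumes \<phi>: "continuous_on (sphere 0 1) \<phi>"
  shows "(\<integral>v. \<phi> v \<partial>cone_volume_measure paral)
    = (\<Sum>p\<in>facets. measure lebesgue paral / (2 * CARD('n)) * \<phi> (facet_normal p))"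
proof -
  let ?D = "restrict_space (hausdorff_measure (CARD('n) - 1)) (regular_boundary paral) :: (real ^ 'n) measure"
  let ?N = "restrict_space borel (sphere 0 1) :: (real ^ 'n) measure"
  let ?w = "\<lambda>x. (x \<bullet> gauss_map paral x) / CARD('n)"
  have G: "gauss_map paral \<in> ?D \<rightarrow>\<^sub>M ?N"
    by (rule measurable_on_facets[OF gauss_map_facet]) (auto simp: space_restrict_space norm_facet_normal)
  have w: "?w x = 1 / norm (g (fst p)) / CARD('n)" if "p \<in> facets" "x \<in> facet_interior p" for p x
    using support_fun_paral(2)[OF that] gauss_map_facet[OF that] by simp
  have w_meas: "?w \<in> borel_measurable ?D"
    by (rule measurable_on_facets[OF w]) auto
  have w_pos: "AE x in ?D. 0 \<le> ?w x"
  proof (rule AE_I2)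
    fix x assume "x \<in> space ?D"
    then have "x \<in> regular_boundary paral" by (simp add: space_restrict_space)
    then obtain p where "p \<in> facets" "x \<in> facet_interior p" by (rule facet_cases)
    from w[OF this] show "0 \<le> ?w x" by simp
  qed
  have \<phi>_meas: "\<phi> \<in> borel_measurable ?N"
    using \<phi> by (rule borel_measurable_continuous_on_restrict)
  have "(\<integral>v. \<phi> v \<partial>cone_volume_measure paral)
      = (\<integral>x. \<phi> (gauss_map paral x) \<partial>density ?D (\<lambda>x. ennreal (?w x)))"
    unfolding cone_volume_measure_def using G \<phi>_meas
    by (subst integral_distr) auto
  also have "\<dots> = (\<integral>x. ?w x *\<^sub>R \<phi> (gauss_map paral x) \<partial>?D)"
    using measurable_compose[OF G \<phi>_meas] w_meas w_pos by (rule integral_density)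
  also have "\<dots> = (\<Sum>p\<in>facets. measure lebesgue paral * norm (g (fst p)) / 2
      * (1 / norm (g (fst p)) / CARD('n) * \<phi> (facet_normal p)))"
    by (rule integral_on_facets) (use w gauss_map_facet in auto)
  also have "\<dots> = (\<Sum>p\<in>facets. measure lebesgue paral / (2 * CARD('n)) * \<phi> (facet_normal p))"
    using g_nonzero by (intro sum.cong) (auto simp: facets_def)
  finally show ?thesis .
qed

end

section \<open>The volume of a centered body in terms of its widths\<close>

context dual_bases
begin

definition coords :: "'a \<Rightarrow> 'a" where
  "coords x = (\<Sum>b\<in>Basis. (x \<bullet> g b) *\<^sub>R b)"

lemma coords_inner: "b \<in> Basis \<Longrightarrow> coords x \<bullet> b = x \<bullet> g b"
  by (simp add: coords_def)

lemma measurable_coords [measurable]: "coords \<in> borel \<rightarrow>\<^sub>M borel"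
  unfolding coords_def by measurable

lemma coords_add: "coords (x + y) = coords x + coords y"
  by (simp add: coords_def inner_add_left scaleR_add_left sum.distrib)

lemma surj_coords: "\<exists>x. coords x = y"
proof
  show "coords (\<Sum>b\<in>Basis. (y \<bullet> b) *\<^sub>R d b) = y"
  proof (rule euclidean_eqI)
    fix c :: 'a assume c: "c \<in> Basis"
    show "coords (\<Sum>b\<in>Basis. (y \<bullet> b) *\<^sub>R d b) \<bullet> c = y \<bullet> c"
      using c by (simp add: coords_inner inner_sum_left dual if_distrib cong: if_cong)
  qed
qed

text \<open>
The linear change of variables to the coordinates of the parallelotope. The image of Lebesgue
measure is translation-invariant, and its scaling factor is read off from the cube of side 2,
whose preimage is the parallelotope; so no determinant is needed.
\<close>

lemma emeasure_coords_vimage: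
  assumes A: "A \<in> sets borel"
  shows "emeasure lborel (coords -` A) = emeasure lborel paral / 2 ^ DIM('a) * emeasure lborel A"
proof -
  define M where "M = distr lborel borel coords"
  have M: "emeasure M A = emeasure lborel (coords -` A)" if "A \<in> sets borel" for A
    unfolding M_def using that by (subst emeasure_distr) auto
  have "sigma_finite_measure M"
  proof (rule sigma_finite_measure.intro, intro exI[of _ "range (\<lambda>n. cball 0 (real n))"] conjI ballI)
    show "\<Union> (range (\<lambda>n. cball 0 (real n))) = space M"
      by (auto simp: real_arch_simple M_def)
    fix a assume "a \<in> range (\<lambda>n. cball (0 :: 'a) (real n))"
    then obtain n where a: "a = cball 0 (real n)" by blast
    have "coords -` a \<subseteq> box_of (\<lambda>_. - real n) (\<lambda>_. real n)"
    proof
      fix x assume "x \<in> coords -` a"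
      then have "\<bar>x \<bullet> g b\<bar> \<le> real n" if "b \<in> Basis" for b
        using Basis_le_norm[OF that, of "coords x"] coords_inner[OF that, of x] by (simp add: a)
      then show "x \<in> box_of (\<lambda>_. - real n) (\<lambda>_. real n)"
        by (auto simp: box_of_def abs_le_iff minus_le_iff)
    qed
    then have "bounded (coords -` a)"
      using compact_imp_bounded[OF compact_box_of] bounded_subset by blast
    then show "emeasure M a \<noteq> \<infinity>"
      using emeasure_bounded_finite[of "coords -` a"] by (simp add: M a)
  qed (auto simp: M_def)
  moreover have "emeasure M ((\<lambda>x. z + x) -` A) = emeasure M A" if A: "A \<in> sets borel" for A z
  proof -
    obtain y where y: "coords y = z" using surj_coords by blast
    have zA: "(\<lambda>x. z + x) -` A \<in> sets borel"
      using measurable_sets[of "\<lambda>x. z + x" borel borel A] A by simp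
    have cA: "coords -` A \<in> sets borel"
      using measurable_sets[OF measurable_coords A] by simp
    have "coords -` (\<lambda>x. z + x) -` A = (\<lambda>x. y + x) -` coords -` A"
      by (auto simp: coords_add y)
    moreover have "emeasure lborel ((\<lambda>x. y + x) -` coords -` A) = emeasure (distr lborel borel ((+) y)) (coords -` A)"
      using cA by (subst emeasure_distr) auto
    ultimately show ?thesis using zA A by (simp add: M lborel_distr_plus)
  qed
  ultimately have "emeasure M A * emeasure lborel (cbox (- One) One :: 'a set)
      = emeasure lborel A * emeasure M (uminus -` cbox (- One) One)"
    using A by (intro translation_invariant_borel_measure_unique) (auto simp: M_def)
  moreover have "uminus -` cbox (- One) One = (cbox (- One) One :: 'a set)"
    by (auto simp: mem_box)
  moreover have "coords -` cbox (- One) One = paral"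
    by (auto simp: mem_box coords_inner box_of_def)
  moreover have "emeasure lborel (cbox (- One) One :: 'a set) = 2 ^ DIM('a)"
  proof -
    have "emeasure lborel (cbox (- One) One :: 'a set) = ennreal (\<Prod>b\<in>Basis. (One - - One :: 'a) \<bullet> b)"
      by (rule emeasure_lborel_cbox) simp
    also have "(\<Prod>b\<in>Basis. (One - - One :: 'a) \<bullet> b) = (\<Prod>b\<in>(Basis :: 'a set). 2)"
      by (rule prod.cong) (simp_all add: inner_add_left)
    finally show ?thesis by (simp add: ennreal_power[symmetric])
  qed
  ultimately have "emeasure M A * 2 ^ DIM('a) = emeasure lborel A * emeasure lborel paral"
    by (simp add: M)
  then have "emeasure M A = emeasure lborel A * emeasure lborel paral / 2 ^ DIM('a)"
    by (subst ennreal_mult_divide_eq[symmetric, where b = "2 ^ DIM('a)"]) (auto simp: power_eq_top_ennreal)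
  then show ?thesis using A by (simp add: M divide_ennreal_def ac_simps)
qed

lemma nn_integral_coords:
  assumes [measurable]: "f \<in> borel_measurable borel"
  shows "(\<integral>\<^sup>+x. f (coords x) \<partial>lborel) = emeasure lborel paral / 2 ^ DIM('a) * (\<integral>\<^sup>+x. f x \<partial>lborel)"
proof -
  let ?c = "emeasure lborel paral / 2 ^ DIM('a)"
  have "distr lborel borel coords = density lborel (\<lambda>_. ?c)"
  proof (rule measure_eqI)
    fix A assume "A \<in> sets (distr lborel borel coords)"
    then have A: "A \<in> sets borel" by simp
    then show "emeasure (distr lborel borel coords) A = emeasure (density lborel (\<lambda>_. ?c)) A"
      by (subst emeasure_distr) (auto simp: emeasure_coords_vimage emeasure_density_const)
  qed simp
  then have "(\<integral>\<^sup>+x. f x \<partial>distr lborel borel coords) = ?c * (\<integral>\<^sup>+x. f x \<partial>lborel)"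
    by (simp add: nn_integral_density nn_integral_cmult)
  then show ?thesis by (simp add: nn_integral_distr)
qed

text \<open>
\<open>K\<close> lies in the box given by the coordinate bounds \<open>- \<beta> b\<close> and \<open>\<alpha> b\<close>. Enlarging \<open>K\<close> to this box in the
exponential integral makes the integral a product of integrals over intervals, and the linear
functional \<open>v\<close> is chosen so that each of them is at most twice the geometric mean of \<open>\<alpha> b\<close> and
\<open>\<beta> b\<close>.
\<close>

theorem centered_volume_le:
  assumes K: "compact K" "0 < measure lebesgue K" "centered K"
  shows "measure lebesgue K
    \<le> measure lebesgue paral * (\<Prod>b\<in>Basis. sqrt (support_fun K (g b) * support_fun K (- g b)))"
proof -
  define \<alpha> where "\<alpha> b = support_fun K (g b)" for b
  define \<beta> where "\<beta> b = support_fun K (- g b)" for b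
  define l where "l b = (\<alpha> b - \<beta> b) / (2 * \<alpha> b * \<beta> b)" for b
  define v where "v = (\<Sum>b\<in>Basis. l b *\<^sub>R g b)"
  define f where "f b y = ennreal (exp (- l b * y)) * indicator {- \<beta> b..\<alpha> b} y" for b y
  have [measurable]: "f b \<in> borel_measurable borel" for b
    unfolding f_def[abs_def] by measurable
  have pos: "0 < \<alpha> b" "0 < \<beta> b" if "b \<in> Basis" for b
    unfolding \<alpha>_def \<beta>_def using centered_support_fun_pos[OF K] g_nonzero[OF that] by auto
  have "ennreal (measure lebesgue K) \<le> (\<integral>\<^sup>+x. ennreal (exp (- (x \<bullet> v))) * indicator K x \<partial>lborel)"
    by (rule centered_volume_le_exp_integral[OF K])
  also have "\<dots> \<le> (\<integral>\<^sup>+x. (\<Prod>b\<in>Basis. f b (coords x \<bullet> b)) \<partial>lborel)"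
  proof (rule nn_integral_mono)
    fix x
    show "ennreal (exp (- (x \<bullet> v))) * indicator K x \<le> (\<Prod>b\<in>Basis. f b (coords x \<bullet> b))"
    proof (cases "x \<in> K")
      case True
      have "f b (coords x \<bullet> b) = ennreal (exp (- l b * (x \<bullet> g b)))" if "b \<in> Basis" for b
      proof -
        have "x \<bullet> g b \<le> \<alpha> b" "- \<beta> b \<le> x \<bullet> g b"
          using inner_le_support_fun[OF K(1) True, of "g b"] inner_le_support_fun[OF K(1) True, of "- g b"]
          by (auto simp: \<alpha>_def \<beta>_def)
        then show ?thesis using that by (simp add: f_def coords_inner)
      qed
      then have "(\<Prod>b\<in>Basis. f b (coords x \<bullet> b)) = ennreal (\<Prod>b\<in>Basis. exp (- l b * (x \<bullet> g b)))"
        by (simp add: prod_ennreal)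
      also have "(\<Prod>b\<in>Basis. exp (- l b * (x \<bullet> g b))) = exp (- (x \<bullet> v))"
        by (simp add: exp_sum[symmetric] v_def inner_sum_right sum_negf)
      finally show ?thesis using True by simp
    qed simp
  qed
  also have "\<dots> = emeasure lborel paral / 2 ^ DIM('a) * (\<integral>\<^sup>+x. (\<Prod>b\<in>Basis. f b (x \<bullet> b)) \<partial>lborel)"
    by (rule nn_integral_coords) measurable
  also have "(\<integral>\<^sup>+x. (\<Prod>b\<in>Basis. f b (x \<bullet> b)) \<partial>lborel) = (\<Prod>b\<in>Basis. \<integral>\<^sup>+y. f b y \<partial>lborel)"
    by (rule nn_integral_lborel_prod) auto
  also have "\<dots> \<le> (\<Prod>b\<in>(Basis :: 'a set). ennreal (2 * sqrt (\<alpha> b * \<beta> b)))"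
    unfolding f_def l_def using pos
    by (intro prod_mono_ennreal exp_integral_le_geometric_mean)
  also have "\<dots> = ennreal (2 ^ DIM('a) * (\<Prod>b\<in>Basis. sqrt (\<alpha> b * \<beta> b)))"
    using pos by (subst prod_ennreal) (auto simp: prod.distrib less_imp_le)
  finally have "ennreal (measure lebesgue K) \<le> emeasure lborel paral / 2 ^ DIM('a)
      * ennreal (2 ^ DIM('a) * (\<Prod>b\<in>Basis. sqrt (\<alpha> b * \<beta> b)))"
    by (simp add: mult_left_mono)
  also note emeasure_paral
  also have "ennreal (measure lebesgue paral) / 2 ^ DIM('a) = ennreal (measure lebesgue paral / 2 ^ DIM('a))"
    by (subst divide_ennreal[symmetric]) (auto simp: ennreal_power[symmetric])
  also have "\<dots> * ennreal (2 ^ DIM('a) * (\<Prod>b\<in>Basis. sqrt (\<alpha> b * \<beta> b)))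
      = ennreal (measure lebesgue paral * (\<Prod>b\<in>Basis. sqrt (\<alpha> b * \<beta> b)))"
    by (subst ennreal_mult'[symmetric]) auto
  finally show ?thesis
    using pos by (subst (asm) ennreal_le_iff)
      (auto simp: \<alpha>_def \<beta>_def less_imp_le intro!: mult_nonneg_nonneg prod_nonneg)
qed

end

section \<open>The inequality\<close>

text \<open>
In the coordinates of the linear map that defines \<open>Q\<close>, the set \<open>Q\<close> is a translate of the unit cube.
Symmetry under \<open>x \<mapsto> - x\<close>, applied to two opposite vertices, forces the translate to be the one
centered at the origin.
\<close>

lemma symmetric_parallelotope_dual_bases:
  fixes Q :: "'a::euclidean_space set"
  assumes "parallelotope Q" and sym: "uminus ` Q = Q"
  obtains d g :: "'a \<Rightarrow> 'a" where "dual_bases d g" "Q = dual_bases.box_of g (\<lambda>_. - 1) (\<lambda>_. 1)"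
proof -
  obtain f p where f: "linear f" "inj f" and Q: "Q = (\<lambda>x. p + f x) ` cbox (0::'a) One"
    using assms(1) unfolding parallelotope_def by blast
  have "surj f" using f by (intro linear_injective_imp_surjective) auto
  define h where "h = inv f"
  have hf: "h (f x) = x" and fh: "f (h x) = x" for x
    using f(2) \<open>surj f\<close> by (simp_all add: h_def surj_f_inv_f)
  have h: "linear h"
    unfolding h_def using f by (intro inj_linear_imp_inv_linear)
  have memQ: "x \<in> Q \<longleftrightarrow> (\<forall>b\<in>Basis. h p \<bullet> b \<le> h x \<bullet> b \<and> h x \<bullet> b \<le> h p \<bullet> b + 1)" for x
  proof -
    have "x \<in> Q \<longleftrightarrow> h (x - p) \<in> cbox 0 One"
    proof
      assume "x \<in> Q"
      then obtain y where "y \<in> cbox 0 One" "x = p + f y" unfolding Q by blast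
      then show "h (x - p) \<in> cbox 0 One" by (simp add: hf)
    next
      assume "h (x - p) \<in> cbox 0 One"
      moreover have "x = p + f (h (x - p))" by (simp add: fh)
      ultimately show "x \<in> Q" unfolding Q by (rule rev_image_eqI)
    qed
    then show ?thesis
      by (simp add: linear_diff[OF h] mem_box inner_diff_left algebra_simps)
  qed
  have hp: "h p \<bullet> b = - 1 / 2" if b: "b \<in> Basis" for b
  proof -
    have neg: "- x \<in> Q" if "x \<in> Q" for x using that sym by blast
    have "p \<in> Q" by (simp add: memQ)
    from neg[OF this] b have 1: "h p \<bullet> b \<le> - (h p \<bullet> b)" "- (h p \<bullet> b) \<le> h p \<bullet> b + 1"
      by (auto simp: memQ linear_neg[OF h])
    have "f (h p + One) \<in> Q" by (simp add: memQ hf inner_add_left)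
    from neg[OF this] b have "h p \<bullet> b \<le> - (h p \<bullet> b + 1)"
      by (auto simp: memQ linear_neg[OF h] hf inner_add_left inner_diff_left)
    with 1 show ?thesis by simp
  qed
  define g where "g b = 2 *\<^sub>R adjoint h b" for b
  define d where "d b = (1 / 2) *\<^sub>R f b" for b
  have g: "x \<bullet> g b = 2 * (h x \<bullet> b)" for x b
    by (simp add: g_def adjoint_works[OF h])
  have D: "dual_bases d g"
  proof
    show "d b \<bullet> g c = (if b = c then 1 else 0)" if "b \<in> Basis" "c \<in> Basis" for b c
      using that by (simp add: g d_def linear_scale[OF h] hf inner_Basis)
    show "x = (\<Sum>b\<in>Basis. (x \<bullet> g b) *\<^sub>R d b)" for x
    proof -
      have "x = f (\<Sum>b\<in>Basis. (h x \<bullet> b) *\<^sub>R b)" by (simp add: euclidean_representation fh)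
      also have "\<dots> = (\<Sum>b\<in>Basis. (h x \<bullet> b) *\<^sub>R f b)" by (simp add: linear_sum[OF f(1)] linear_scale[OF f(1)])
      finally show ?thesis by (simp add: g d_def)
    qed
  qed
  moreover have "Q = dual_bases.box_of g (\<lambda>_. - 1) (\<lambda>_. 1)"
  proof -
    have "x \<in> Q \<longleftrightarrow> (\<forall>b\<in>Basis. - 1 \<le> x \<bullet> g b \<and> x \<bullet> g b \<le> 1)" for x
      unfolding memQ by (intro ball_cong) (auto simp: hp g)
    then show ?thesis by (auto simp: dual_bases.box_of_def[OF D])
  qed
  ultimately show thesis by (rule that)
qed

context dual_bases_vec
begin

text \<open>
At the normal in direction \<open>g b\<close> the quotient of the support functions is the support function of \<open>K\<close>
at \<open>g b\<close> itself, because that of the parallelotope is \<open>1 / norm (g b)\<close> at the unit normal. The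
integral is thus, up to the factor \<open>measure lebesgue paral / CARD('n)\<close>, the logarithm of the
product that bounds the volume quotient.
\<close>

theorem log_minkowski_paral:
  assumes "convex_body K" "centered K"
  shows "(\<integral>v. ln (support_fun K v / support_fun paral v) \<partial>cone_volume_measure paral)
      \<ge> measure lebesgue paral / CARD('n) * ln (measure lebesgue K / measure lebesgue paral)"
proof -
  have K: "compact K" and int: "interior K \<noteq> {}" using assms(1) by (auto simp: convex_body_def)
  then have ne: "K \<noteq> {}" by auto
  have pos_vol: "0 < measure lebesgue S" if "compact S" "interior S \<noteq> {}" for S :: "(real ^ 'n) set"
  proof -
    have "S \<in> lmeasurable" using that(1) by (rule lmeasurable_compact)
    moreover have "\<not> negligible S"
      using that(2) open_not_negligible[of "interior S"] negligible_subset[of S "interior S"] interior_subset by blast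
    ultimately show ?thesis
      by (metis measure_nonneg measure_le_0_iff negligible_iff_measure0 not_le)
  qed
  have volK: "0 < measure lebesgue K" using pos_vol[OF K int] .
  have int0: "0 \<in> interior paral" unfolding interior_paral by simp
  then have volQ: "0 < measure lebesgue paral"
    by (intro pos_vol[OF compact_box_of]) blast
  have hK: "0 < support_fun K v" if "v \<noteq> 0" for v
    by (rule centered_support_fun_pos[OF K volK assms(2) that])
  have hQ: "0 < support_fun paral v" if "v \<noteq> 0" for v
  proof -
    obtain e where e: "0 < e" "cball 0 e \<subseteq> paral" using int0 by (auto simp: mem_interior_cball)
    have "(e / norm v) *\<^sub>R v \<in> paral" using e that by (intro subsetD[OF e(2)]) simp
    then have "((e / norm v) *\<^sub>R v) \<bullet> v \<le> support_fun paral v"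
      by (rule inner_le_support_fun[OF compact_box_of])
    moreover have "0 < ((e / norm v) *\<^sub>R v) \<bullet> v" using e(1) that by simp
    ultimately show ?thesis by linarith
  qed
  have cont: "continuous_on (sphere 0 1) (\<lambda>v. ln (support_fun K v / support_fun paral v))"
  proof (intro continuous_intros continuous_on_support_fun K ne compact_box_of)
    show "paral \<noteq> {}" using volQ by auto
    have "0 < support_fun K v \<and> 0 < support_fun paral v" if "v \<in> sphere 0 1" for v
      using that by (intro conjI hK hQ) auto
    then show "\<forall>v\<in>sphere 0 1. support_fun paral v \<noteq> 0"
      "\<forall>v\<in>sphere 0 1. support_fun K v / support_fun paral v \<noteq> 0"
      by fastforce+
  qed
  define V where "V = measure lebesgue paral / (2 * CARD('n))"
  have "(\<integral>v. ln (support_fun K v / support_fun paral v) \<partial>cone_volume_measure paral)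
      = (\<Sum>p\<in>facets. V * ln (support_fun K (snd p *\<^sub>R g (fst p))))"
  proof (subst integral_cone_volume_measure[OF cont], rule sum.cong[OF refl])
    fix p assume p: "p \<in> facets"
    then have n: "0 < norm (g (fst p))" using g_nonzero by (auto simp: facets_def)
    have "facet_normal p = (1 / norm (g (fst p))) *\<^sub>R (snd p *\<^sub>R g (fst p))"
      by (simp add: facet_normal_def)
    then have "support_fun K (facet_normal p) = 1 / norm (g (fst p)) * support_fun K (snd p *\<^sub>R g (fst p))"
      using support_fun_scaleR[OF K ne, of "1 / norm (g (fst p))" "snd p *\<^sub>R g (fst p)"] by simp
    then have "support_fun K (facet_normal p) / support_fun paral (facet_normal p) = support_fun K (snd p *\<^sub>R g (fst p))"
      using n support_fun_paral(1)[OF p] by simp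
    then show "measure lebesgue paral / (2 * CARD('n)) * ln (support_fun K (facet_normal p) / support_fun paral (facet_normal p))
        = V * ln (support_fun K (snd p *\<^sub>R g (fst p)))"
      by (simp add: V_def)
  qed
  also have "\<dots> = V * (\<Sum>b\<in>Basis. ln (support_fun K (g b)) + ln (support_fun K (- g b)))"
    unfolding facets_def by (simp add: sum.cartesian_product' sum_distrib_left distrib_left)
  also have "\<dots> = V * (2 * ln (\<Prod>b\<in>Basis. sqrt (support_fun K (g b) * support_fun K (- g b))))"
  proof -
    have pos: "0 < support_fun K (g b)" "0 < support_fun K (- g b)" if "b \<in> Basis" for b
      using hK g_nonzero[OF that] by auto
    have "ln (\<Prod>b\<in>Basis. sqrt (support_fun K (g b) * support_fun K (- g b)))
        = (\<Sum>b\<in>Basis. ln (sqrt (support_fun K (g b) * support_fun K (- g b))))"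
    proof (rule ln_prod)
      show "sqrt (support_fun K (g b) * support_fun K (- g b)) \<noteq> 0" if "b \<in> Basis" for b
        using pos[OF that] by simp
    qed simp
    also have "\<dots> = (\<Sum>b\<in>Basis. (ln (support_fun K (g b)) + ln (support_fun K (- g b))) / 2)"
    proof (rule sum.cong[OF refl])
      have "ln (sqrt (r * t)) = (ln r + ln t) / 2" if "0 < r" "0 < t" for r t :: real
        using that by (simp add: ln_sqrt ln_mult_pos)
      then show "ln (sqrt (support_fun K (g b) * support_fun K (- g b)))
          = (ln (support_fun K (g b)) + ln (support_fun K (- g b))) / 2" if "b \<in> Basis" for b
        using pos[OF that] by blast
    qed
    also have "\<dots> = (\<Sum>b\<in>Basis. ln (support_fun K (g b)) + ln (support_fun K (- g b))) / 2"
      by (simp add: sum_divide_distrib)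
    finally show ?thesis by simp
  qed
  also have "\<dots> \<ge> V * (2 * ln (measure lebesgue K / measure lebesgue paral))"
  proof -
    have "measure lebesgue K / measure lebesgue paral
        \<le> (\<Prod>b\<in>Basis. sqrt (support_fun K (g b) * support_fun K (- g b)))"
      using centered_volume_le[OF K volK assms(2)] volQ by (simp add: pos_divide_le_eq mult.commute)
    then have "ln (measure lebesgue K / measure lebesgue paral)
        \<le> ln (\<Prod>b\<in>Basis. sqrt (support_fun K (g b) * support_fun K (- g b)))"
      using volK volQ by (intro ln_mono) auto
    moreover have "0 \<le> V" using volQ by (simp add: V_def)
    ultimately show ?thesis by (intro mult_left_mono) auto
  qed
  finally show ?thesis by (simp add: V_def)
qed

end

theorem corollary1p4:
  fixes Q K :: "(real ^ 'n::finite) set" and u :: "'n::finite \<Rightarrow> real ^ 'n"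
  assumes "parallelotope Q"
    and "uminus ` Q = Q"
    and "facet_normals Q = range u \<union> uminus ` range u"
    and "convex_body K"
    and "centered K"
    and "\<And>i j. support_fun K (u i) / support_fun K (- u i)
               = support_fun K (u j) / support_fun K (- u j)"
  shows "(\<integral>v. ln (support_fun K v / support_fun Q v) \<partial>cone_volume_measure Q)
           \<ge> measure lebesgue Q / CARD('n) * ln (measure lebesgue K / measure lebesgue Q)"
proof -
  obtain d g :: "real ^ 'n \<Rightarrow> real ^ 'n" where D: "dual_bases d g"
    and Q: "Q = dual_bases.box_of g (\<lambda>_. - 1) (\<lambda>_. 1)"
    using symmetric_parallelotope_dual_bases[OF assms(1,2)] .
  interpret dual_bases_vec d g by (rule dual_bases_vec.intro[OF D])
  show ?thesis
    unfolding Q by (rule log_minkowski_paral[OF assms(4,5)])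
qed

end
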